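(* Let $H=L(r_1,\dots,r_m)$ be a truncated parallelogram. Then $\mathbf{M}(H)\cong\mathbf{J}(\mathbf{F}(H))$.
   Context: Draw the regular hexagonal tiling so that each hexagon has two vertical edges; the right neighbor of a hexagon is the one sharing its right vertical edge, and its upper-left neighbor is the one sharing its upper-left slanted edge. For integers $r_1\ge\cdots\ge r_m\ge1$, $L(r_1,\dots,r_m)$ is the plane graph which is the union of hexagons $h_{ij}$ ($1\le i\le m$, $1\le j\le r_i$), where $h_{i,j+1}$ is the right neighbor of $h_{i,j}$ and $h_{i+1,1}$ is the upper-left neighbor of $h_{i,1}$. Its vertices are properly 2-colored so that the lowest vertex of each hexagon is white. $\mathbf{F}(H)$ is the poset on the hexagons with $h_{ij}\preceq h_{kl}$ iff $i\le k$ and $j\le l$. For a finite poset $\mathbf{P}$, $\mathbf{J}(\mathbf{P})$ is the lattice of order ideals ordered by inclusion. A 1-factor is a perfect matching, $\mathcal{M}(H)$ the set of them; for $M\in\mathcal{M}(H)$ a cycle is $M$-alternating if its edges alternate in/out of $M$, and proper if each of its edges in $M$ goes from white to black end-vertex along the clockwise orientation. $\vec Z(H)$ has vertex set $\mathcal{M}(H)$ and an arc $M_1\to M_2$ when $M_1\oplus M_2$ bounds an inner face and is a proper $M_1$-alternating cycle; $\mathbf{M}(H)$ is the poset on $\mathcal{M}(H)$ with $M_1\preceq M_2$ iff $\vec Z(H)$ has a directed path from $M_2$ to $M_1$. *)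

theory Defs
  imports "HOL-Analysis.Analysis"
begin

section \<open>Plane graphs on the hexagonal lattice\<close>

text \<open>
  The regular hexagonal tiling with edge length 1 and two vertical edges per hexagon has all
  corners and centres at points \<open>(sqrt 3 / 2 * x, y / 2)\<close> with \<open>x\<close>, \<open>y\<close> integers.
  Such a point is represented by the integer pair \<open>(x, y)\<close>.
\<close>

type_synonym pt = "int \<times> int"

definition pos :: "pt \<Rightarrow> real \<times> real" where
  "pos p = (sqrt 3 / 2 * real_of_int (fst p), real_of_int (snd p) / 2)"

text \<open>Vertex set and edge set; edges are drawn as straight segments between the end-vertices.\<close>

type_synonym plane_graph = "pt set \<times> pt set set"

definition verts :: "plane_graph \<Rightarrow> pt set" where
  "verts H = fst H"

definition edges :: "plane_graph \<Rightarrow> pt set set" where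
  "edges H = snd H"

definition draw :: "pt set set \<Rightarrow> (real \<times> real) set" where
  "draw E = (\<Union>e\<in>E. convex hull (pos ` e))"

definition inner_faces :: "plane_graph \<Rightarrow> (real \<times> real) set set" where
  "inner_faces H = {f \<in> components (- (pos ` verts H \<union> draw (edges H))). bounded f}"

text \<open>A cycle is given by the list of its vertices in cyclic order.\<close>

definition cycle_edges :: "'a list \<Rightarrow> 'a set set" where
  "cycle_edges vs = {{vs ! k, vs ! (Suc k mod length vs)} | k. k < length vs}"

definition is_cycle :: "plane_graph \<Rightarrow> pt list \<Rightarrow> bool" where
  "is_cycle H vs \<longleftrightarrow> 3 \<le> length vs \<and> distinct vs \<and> set vs \<subseteq> verts H \<and> cycle_edges vs \<subseteq> edges H"

text \<open>
  Twice the signed area enclosed by the closed polygon through \<open>vs\<close> (shoelace formula); a simple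
  closed polygon is traversed clockwise iff it is negative.
\<close>

definition signed_area2 :: "pt list \<Rightarrow> real" where
  "signed_area2 vs = (\<Sum>k<length vs.
     let p = pos (vs ! k); q = pos (vs ! (Suc k mod length vs))
     in fst p * snd q - fst q * snd p)"

definition clockwise :: "pt list \<Rightarrow> bool" where
  "clockwise vs \<longleftrightarrow> signed_area2 vs < 0"

section \<open>Truncated parallelograms\<close>

text \<open>Hexagons are represented by their centres. The corners are listed clockwise from the top one;
  the fourth, \<open>corners c ! 3\<close>, is the lowest.\<close>

definition corners :: "pt \<Rightarrow> pt list" where
  "corners c = (case c of (x, y) \<Rightarrow>
     [(x, y + 2), (x + 1, y + 1), (x + 1, y - 1), (x, y - 2), (x - 1, y - 1), (x - 1, y + 1)])"

definition right_nbr :: "pt \<Rightarrow> pt" where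
  "right_nbr c = (fst c + 2, snd c)"

definition upper_left_nbr :: "pt \<Rightarrow> pt" where
  "upper_left_nbr c = (fst c - 1, snd c + 3)"

text \<open>The hexagon \<open>h\<^sub>i\<^sub>j\<close>, for \<open>i, j \<ge> 1\<close>, with \<open>h\<^sub>1\<^sub>1\<close> centred at the origin.\<close>

definition hex :: "nat \<Rightarrow> nat \<Rightarrow> pt" where
  "hex i j = (right_nbr ^^ (j - 1)) ((upper_left_nbr ^^ (i - 1)) (0, 0))"

definition hexagons :: "nat \<Rightarrow> (nat \<Rightarrow> nat) \<Rightarrow> pt set" where
  "hexagons m r = {hex i j | i j. 1 \<le> i \<and> i \<le> m \<and> 1 \<le> j \<and> j \<le> r i}"

text \<open>The graph \<open>L(r 1, \<dots>, r m)\<close>.\<close>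

definition trunc_para :: "nat \<Rightarrow> (nat \<Rightarrow> nat) \<Rightarrow> plane_graph" where
  "trunc_para m r =
     (\<Union>c\<in>hexagons m r. set (corners c), \<Union>c\<in>hexagons m r. cycle_edges (corners c))"

text \<open>
  The colouring of the hexagonal lattice in which the lowest corner of each hexagon is white:
  all hexagon centres here have second coordinate divisible by 3. See \<open>white_lowest\<close> and
  \<open>white_proper\<close> below; as a truncated parallelogram is connected, these properties determine the
  colouring of its vertices.
\<close>

definition white :: "pt \<Rightarrow> bool" where
  "white v \<longleftrightarrow> snd v mod 3 = 1"

section \<open>1-factors and the Z-transformation digraph\<close>

definition perfect_matchings :: "plane_graph \<Rightarrow> pt set set set" where
  "perfect_matchings H = {M. M \<subseteq> edges H \<and> (\<forall>v\<in>verts H. \<exists>!e. e \<in> M \<and> v \<in> e)}"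

definition alternating :: "pt set set \<Rightarrow> pt list \<Rightarrow> bool" where
  "alternating M vs \<longleftrightarrow> (let n = length vs in \<forall>k<n.
     ({vs ! k, vs ! (Suc k mod n)} \<in> M) \<noteq> ({vs ! (Suc k mod n), vs ! (Suc (Suc k) mod n)} \<in> M))"

text \<open>To be used for clockwise \<open>vs\<close>.\<close>

definition proper :: "pt set set \<Rightarrow> pt list \<Rightarrow> bool" where
  "proper M vs \<longleftrightarrow> (let n = length vs in \<forall>k<n.
     {vs ! k, vs ! (Suc k mod n)} \<in> M \<longrightarrow> white (vs ! k) \<and> \<not> white (vs ! (Suc k mod n)))"

definition Z_arc :: "plane_graph \<Rightarrow> pt set set \<Rightarrow> pt set set \<Rightarrow> bool" where
  "Z_arc H M1 M2 \<longleftrightarrow> M1 \<in> perfect_matchings H \<and> M2 \<in> perfect_matchings H \<and>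
     (\<exists>f\<in>inner_faces H. frontier f = draw (sym_diff M1 M2)) \<and>
     (\<exists>vs. is_cycle H vs \<and> cycle_edges vs = sym_diff M1 M2 \<and>
           clockwise vs \<and> alternating M1 vs \<and> proper M1 vs)"

section \<open>Posets\<close>

text \<open>A poset is given by its carrier and its order relation, which is only relevant on the carrier.\<close>

type_synonym 'a poset = "'a set \<times> ('a \<Rightarrow> 'a \<Rightarrow> bool)"

definition poset_isomorphic :: "'a poset \<Rightarrow> 'b poset \<Rightarrow> bool" where
  "poset_isomorphic P Q \<longleftrightarrow> (\<exists>\<phi>. bij_betw \<phi> (fst P) (fst Q) \<and>
     (\<forall>x\<in>fst P. \<forall>y\<in>fst P. snd P x y \<longleftrightarrow> snd Q (\<phi> x) (\<phi> y)))"

definition ideal_lattice :: "'a poset \<Rightarrow> 'a set poset" where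
  "ideal_lattice P =
     ({I. I \<subseteq> fst P \<and> (\<forall>x\<in>I. \<forall>y\<in>fst P. snd P y x \<longrightarrow> y \<in> I)}, (\<subseteq>))"

definition hexagon_poset :: "nat \<Rightarrow> (nat \<Rightarrow> nat) \<Rightarrow> pt poset" where
  "hexagon_poset m r = (hexagons m r,
     \<lambda>a b. \<exists>i j k l. 1 \<le> i \<and> 1 \<le> j \<and> 1 \<le> k \<and> 1 \<le> l \<and>
       a = hex i j \<and> b = hex k l \<and> i \<le> k \<and> j \<le> l)"

definition matching_poset :: "plane_graph \<Rightarrow> pt set set poset" where
  "matching_poset H = (perfect_matchings H, \<lambda>M1 M2. (Z_arc H)\<^sup>*\<^sup>* M2 M1)"

section \<open>Consistency of the encoding\<close>

lemma hex_eq: "hex i j = (2 * int (j - 1) - int (i - 1), 3 * int (i - 1))"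
proof -
  have u: "(upper_left_nbr ^^ n) c = (fst c - int n, snd c + 3 * int n)" for n c
    by (induction n) (auto simp: upper_left_nbr_def)
  have "(right_nbr ^^ n) c = (fst c + 2 * int n, snd c)" for n c
    by (induction n) (auto simp: right_nbr_def)
  with u show ?thesis
    by (simp add: hex_def)
qed

lemma hex_inject:
  assumes "1 \<le> i" "1 \<le> j" "1 \<le> k" "1 \<le> l"
  shows "hex i j = hex k l \<longleftrightarrow> i = k \<and> j = l"
  using assms by (auto simp: hex_eq)

lemma cycle_edges_corners:
  "cycle_edges (corners (x, y)) =
     {{(x, y + 2), (x + 1, y + 1)}, {(x + 1, y + 1), (x + 1, y - 1)}, {(x + 1, y - 1), (x, y - 2)},
      {(x, y - 2), (x - 1, y - 1)}, {(x - 1, y - 1), (x - 1, y + 1)}, {(x - 1, y + 1), (x, y + 2)}}"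
proof -
  have "cycle_edges vs = (\<lambda>k. {vs ! k, vs ! (Suc k mod length vs)}) ` {..<length vs}" for vs :: "pt list"
    by (auto simp: cycle_edges_def)
  then show ?thesis
    by (simp add: corners_def lessThan_Suc insert_commute)
qed

lemma right_nbr_shared_edge:
  "{corners c ! 1, corners c ! 2} \<in> cycle_edges (corners c) \<inter> cycle_edges (corners (right_nbr c))"
proof -
  obtain x y where "c = (x, y)"
    by (cases c)
  then show ?thesis
    by (simp add: right_nbr_def cycle_edges_corners) (simp add: corners_def doubleton_eq_iff)
qed

lemma upper_left_nbr_shared_edge:
  "{corners c ! 5, corners c ! 0} \<in> cycle_edges (corners c) \<inter> cycle_edges (corners (upper_left_nbr c))"
proof -
  obtain x y where "c = (x, y)"
    by (cases c)
  then show ?thesis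
    by (simp add: upper_left_nbr_def cycle_edges_corners) (simp add: corners_def doubleton_eq_iff)
qed

lemma corners_clockwise: "clockwise (corners c)"
proof -
  obtain x y where c: "c = (x, y)"
    by (cases c)
  have "signed_area2 (corners c) = - 3 * sqrt 3"
    unfolding signed_area2_def by (simp add: c corners_def pos_def lessThan_Suc Let_def field_simps)
  then show ?thesis
    by (simp add: clockwise_def)
qed

lemma white_lowest:
  assumes "c \<in> hexagons m r"
  shows "white (corners c ! 3)"
proof -
  obtain i j where c: "c = hex i j"
    using assms by (auto simp: hexagons_def)
  have "(3 * int (i - 1) - 2) mod 3 = 1"
    by presburger
  then show ?thesis
    by (simp add: c hex_eq white_def corners_def)
qed

lemma white_proper:
  assumes "{u, v} \<in> edges (trunc_para m r)"
  shows "white u \<noteq> white v"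
proof -
  obtain i j where "{u, v} \<in> cycle_edges (corners (hex i j))"
    using assms by (auto simp: edges_def trunc_para_def hexagons_def)
  moreover define x where "x = 2 * int (j - 1) - int (i - 1)"
  moreover define n where "n = int (i - 1)"
  ultimately have e: "{u, v} \<in> cycle_edges (corners (x, 3 * n))"
    by (simp add: hex_eq)
  have w: "white (z, 3 * n + 2) = False" "white (z, 3 * n - 2) = True"
    "white (z, 3 * n + 1) = True" "white (z, 3 * n - 1) = False" for z
    unfolding white_def snd_conv by presburger+
  show ?thesis
    using e unfolding cycle_edges_corners by (elim insertE emptyE; unfold doubleton_eq_iff; metis w)
qed

end

theory Submission
  imports Defs
begin

text \<open>
  Write \<open>h(a,k)\<close> for the hexagon \<open>h\<^sub>i\<^sub>j\<close> with \<open>i = a + 1\<close> and \<open>j = k + 1\<close>. The vertical edges cut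
  \<open>H\<close> into horizontal zigzag paths. Going through these paths from the bottom, one sees that a 1-factor
  contains exactly one vertical edge of each row \<open>a\<close>, say the \<open>P (a + 1)\<close>-th one, that the sequence \<open>P\<close>
  is weakly decreasing, and that \<open>P\<close> determines the 1-factor. The hexagons to the left of the
  chosen vertical edges form an order ideal, and every order ideal arises in this way.

  The inner faces of \<open>H\<close> are its hexagons: from the centre of any other hexagon of the tiling a
  horizontal ray escapes to infinity without meeting \<open>H\<close>. Hence an arc of the Z-transformation
  digraph rotates a single hexagon \<open>h(a,k)\<close>, and the sign of the enclosed area shows that it moves the
  vertical edge of row \<open>a\<close> from the right side of \<open>h(a,k)\<close> to its left side, that is, it removes
  \<open>h(a,k)\<close> from the ideal. Conversely, if \<open>Q \<le> P\<close> and \<open>Q \<noteq> P\<close>, lowering \<open>P\<close> by one in the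
  topmost row in which it exceeds \<open>Q\<close> yields a weakly decreasing sequence again, so \<open>Q\<close> can be reached.
\<close>

section \<open>Coordinates on the hexagonal lattice\<close>

text \<open>
  \<open>wv a k\<close> and \<open>bv a k\<close> are the lowest and the lower left corner of \<open>hx a k\<close>. The zigzag path with
  index \<open>a\<close> is \<open>bv a 0, wv a 0, bv a 1, wv a 1, \<dots>\<close>; its edges are \<open>el\<close> and \<open>er\<close>, and \<open>ev a k\<close> is
  the left vertical edge of \<open>hx a k\<close>, joining the zigzag paths \<open>a\<close> and \<open>a + 1\<close>.
\<close>

definition wv :: "nat \<Rightarrow> nat \<Rightarrow> pt" where
  "wv a k = (2 * int k - int a, 3 * int a - 2)"

definition bv :: "nat \<Rightarrow> nat \<Rightarrow> pt" where
  "bv a k = (2 * int k - int a - 1, 3 * int a - 1)"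

definition el :: "nat \<Rightarrow> nat \<Rightarrow> pt set" where
  "el a k = {wv a k, bv a k}"

definition er :: "nat \<Rightarrow> nat \<Rightarrow> pt set" where
  "er a k = {wv a k, bv a (Suc k)}"

definition ev :: "nat \<Rightarrow> nat \<Rightarrow> pt set" where
  "ev a k = {wv (Suc a) k, bv a k}"

definition hx :: "nat \<Rightarrow> nat \<Rightarrow> pt" where
  "hx a k = hex (Suc a) (Suc k)"

lemma hx_eq: "hx a k = (2 * int k - int a, 3 * int a)"
  by (simp add: hx_def hex_eq)

lemma hx_inject [simp]: "hx a k = hx b l \<longleftrightarrow> a = b \<and> k = l"
  by (auto simp: hx_eq)

lemma vertex_inject [simp]:
  "wv a k = wv b l \<longleftrightarrow> a = b \<and> k = l"
  "bv a k = bv b l \<longleftrightarrow> a = b \<and> k = l"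
  "wv a k \<noteq> bv b l" "bv b l \<noteq> wv a k"
  by (auto simp: wv_def bv_def) presburger+

lemma white_vertex [simp]: "white (wv a k)" "\<not> white (bv a k)"
  unfolding white_def wv_def bv_def snd_conv by presburger+

lemma edge_inject [simp]:
  "el a k = el b l \<longleftrightarrow> a = b \<and> k = l"
  "er a k = er b l \<longleftrightarrow> a = b \<and> k = l"
  "ev a k = ev b l \<longleftrightarrow> a = b \<and> k = l"
  "el a k \<noteq> er b l" "er b l \<noteq> el a k"
  "el a k \<noteq> ev b l" "ev b l \<noteq> el a k"
  "er a k \<noteq> ev b l" "ev b l \<noteq> er a k"
  by (auto simp: el_def er_def ev_def doubleton_eq_iff)

lemma vertex_in_edge [simp]:
  "wv a k \<in> el b l \<longleftrightarrow> a = b \<and> k = l"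
  "wv a k \<in> er b l \<longleftrightarrow> a = b \<and> k = l"
  "wv a k \<in> ev b l \<longleftrightarrow> a = Suc b \<and> k = l"
  "bv a k \<in> el b l \<longleftrightarrow> a = b \<and> k = l"
  "bv a k \<in> er b l \<longleftrightarrow> a = b \<and> k = Suc l"
  "bv a k \<in> ev b l \<longleftrightarrow> a = b \<and> k = l"
  by (auto simp: el_def er_def ev_def)

lemma corners_hx:
  "corners (hx a k) = [bv (Suc a) (Suc k), wv (Suc a) (Suc k), bv a (Suc k), wv a k, bv a k, wv (Suc a) k]"
  by (simp add: corners_def hx_eq wv_def bv_def)

lemma cycle_edges_hx:
  "cycle_edges (corners (hx a k)) =
     {el a k, er a k, ev a k, ev a (Suc k), er (Suc a) k, el (Suc a) (Suc k)}"
proof -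
  have "cycle_edges vs = (\<lambda>k. {vs ! k, vs ! (Suc k mod length vs)}) ` {..<length vs}" for vs :: "pt list"
    by (auto simp: cycle_edges_def)
  then show ?thesis
    by (simp add: corners_hx lessThan_Suc el_def er_def ev_def) (simp add: insert_commute)
qed

lemma Union_cycle_edges: "\<Union> (cycle_edges vs) = set vs"
proof
  show "\<Union> (cycle_edges vs) \<subseteq> set vs"
    by (auto simp: cycle_edges_def intro!: nth_mem mod_less_divisor)
  show "set vs \<subseteq> \<Union> (cycle_edges vs)"
  proof
    fix v assume "v \<in> set vs"
    then obtain k where "k < length vs" "v = vs ! k"
      by (metis in_set_conv_nth)
    then show "v \<in> \<Union> (cycle_edges vs)"
      unfolding cycle_edges_def by blast
  qed
qed

section \<open>1-factors and weakly decreasing sequences\<close>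

text \<open>
  Here \<open>l k\<close> and \<open>r k\<close> say that the \<open>k\<close>-th white vertex of a zigzag path is matched along \<open>el\<close> and
  \<open>er\<close>; the white vertex \<open>p\<close> is matched downwards, and \<open>q\<close> is the black vertex left over.
\<close>

lemma zigzag:
  fixes l r :: "nat \<Rightarrow> bool"
  assumes "p \<le> s"
    and white: "\<And>k. k \<le> s \<Longrightarrow> k \<noteq> p \<Longrightarrow> l k \<noteq> r k"
    and removed: "\<not> l p" "\<not> r p" and last: "\<not> r s"
    and black: "\<And>k. k < s \<Longrightarrow> \<not> (r k \<and> l (Suc k))"
  obtains q where "q \<le> p" "\<And>k. k \<le> s \<Longrightarrow> l k \<longleftrightarrow> k < q \<or> p < k"
    "\<And>k. k \<le> s \<Longrightarrow> r k \<longleftrightarrow> q \<le> k \<and> k < p"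
proof -
  \<comment> \<open>The first white vertex before \<open>p\<close> matched along \<open>er\<close>;
    the disjunct \<open>k = p\<close> gives \<open>q = p\<close> if there is none.\<close>
  define q where "q = (LEAST k. k = p \<or> r k)"
  have q: "q = p \<or> r q"
    unfolding q_def by (rule LeastI[of _ p]) simp
  have qp: "q \<le> p"
    unfolding q_def by (rule Least_le) simp
  have below: "\<not> r k" if "k < q" for k
    using that not_less_Least unfolding q_def by blast
  \<comment> \<open>An edge \<open>er\<close> at \<open>k\<close> occupies the next black vertex, so
    the next white vertex before \<open>p\<close> cannot use \<open>el\<close> and uses
    \<open>er\<close> as well.\<close>
  have mid: "r k" if "q \<le> k" "k < p" for k
    using that
  proof (induction k rule: dec_induct)
    case base
    then show ?case using q by simp
  next
    case (step n)
    then show ?case using white[of "Suc n"] black[of n] \<open>p \<le> s\<close> by auto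
  qed
  \<comment> \<open>Downwards from the end of the path: the last white vertex can only use
    \<open>el\<close>, which blocks \<open>er\<close> at its predecessor.\<close>
  have above: "l k" if "p < k" "k \<le> s" for k
    using that(2,1)
  proof (induction k rule: inc_induct)
    case base
    then show ?case using white[of s] last by auto
  next
    case (step n)
    then show ?case using white[of n] black[of n] by auto
  qed
  show ?thesis
  proof
    show "q \<le> p" by fact
    show "l k \<longleftrightarrow> k < q \<or> p < k" if "k \<le> s" for k
      by (metis above below linorder_less_linear mid not_le order_less_le_trans qp removed(1) that white)
    show "r k \<longleftrightarrow> q \<le> k \<and> k < p" if "k \<le> s" for k
      by (metis above below linorder_less_linear mid not_le removed(2) that white)
  qed
qed

section \<open>The graph \<open>H\<close> in zigzag coordinates\<close>

locale truncated_parallelogram =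
  fixes m :: nat and r :: "nat \<Rightarrow> nat"
  assumes m_pos: "1 \<le> m"
    and r_decr: "\<And>i. 1 \<le> i \<Longrightarrow> i < m \<Longrightarrow> r (Suc i) \<le> r i"
    and r_last: "1 \<le> r m"
begin

abbreviation H :: plane_graph where
  "H \<equiv> trunc_para m r"

text \<open>
  \<open>width a\<close> is the last index on the zigzag path \<open>a \<le> m\<close>; on the lowest path \<open>wv 0 (width 0)\<close> is
  missing, and on the highest one \<open>bv m 0\<close>.
\<close>

definition width :: "nat \<Rightarrow> nat" where
  "width a = (if a = 0 then r 1 else r a)"

lemma width_simps [simp]: "width 0 = r (Suc 0)" "width (Suc a) = r (Suc a)"
  by (auto simp: width_def)

lemma width_decr: "a < m \<Longrightarrow> r (Suc a) \<le> width a"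
  using r_decr[of a] by (auto simp: width_def)

lemma r_pos:
  assumes "a < m"
  shows "0 < r (Suc a)"
proof -
  have "Suc a \<le> m" using assms by simp
  then have "r m \<le> r (Suc a)"
    by (induction rule: inc_induct) (use r_decr in \<open>auto intro: order_trans\<close>)
  then show ?thesis using r_last by simp
qed

lemma hexagons_hx: "hexagons m r = {hx a k | a k. a < m \<and> k < r (Suc a)}"
proof -
  have "\<exists>a k. hex i j = hx a k \<and> a < m \<and> k < r (Suc a)"
    if "1 \<le> i" "i \<le> m" "1 \<le> j" "j \<le> r i" for i j
    using that by (intro exI[of _ "i - 1"] exI[of _ "j - 1"]) (auto simp: hx_def)
  moreover have "\<exists>i j. hx a k = hex i j \<and> 1 \<le> i \<and> i \<le> m \<and> 1 \<le> j \<and> j \<le> r i"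
    if "a < m" "k < r (Suc a)" for a k
    using that by (intro exI[of _ "Suc a"] exI[of _ "Suc k"]) (auto simp: hx_def)
  ultimately show ?thesis
    unfolding hexagons_def by blast
qed

lemma hx_in_hexagons: "hx a k \<in> hexagons m r \<longleftrightarrow> a < m \<and> k < r (Suc a)"
  by (auto simp: hexagons_hx)

lemma edges_H:
  "edges H = {el a k | a k. a \<le> m \<and> k \<le> width a \<and> (a = 0 \<longrightarrow> k < width a) \<and> (a = m \<longrightarrow> 0 < k)} \<union>
     {er a k | a k. a \<le> m \<and> k < width a} \<union> {ev a k | a k. a < m \<and> k \<le> r (Suc a)}" (is "_ = ?R")
proof -
  have E: "edges H = (\<Union>(a, k)\<in>{(a, k). a < m \<and> k < r (Suc a)}. cycle_edges (corners (hx a k)))"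
    by (auto simp: edges_def trunc_para_def hexagons_hx)
  have "cycle_edges (corners (hx a k)) \<subseteq> ?R" if "a < m" "k < r (Suc a)" for a k
    using that width_decr[of a] by (auto simp: cycle_edges_hx)
  then have "edges H \<subseteq> ?R"
    unfolding E by blast
  moreover have "el a k \<in> edges H" if "a \<le> m" "k \<le> width a" "a = 0 \<longrightarrow> k < width a" "a = m \<longrightarrow> 0 < k" for a k
  \<comment> \<open>In the first column or on the lowest path the edge is the lower left side of the
    hexagon above it; otherwise it is the upper right side of the hexagon below it.\<close>
  proof (cases "k = 0 \<or> a = 0")
    case True
    then have "el a k \<in> cycle_edges (corners (hx a k))" "a < m" "k < r (Suc a)"
      using that m_pos r_pos[of a] by (auto simp: cycle_edges_hx)
    then show ?thesis unfolding E by blast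
  next
    case False
    then obtain b l where "a = Suc b" "k = Suc l"
      by (metis not0_implies_Suc)
    then have "el a k \<in> cycle_edges (corners (hx b l))" "b < m" "l < r (Suc b)"
      using that by (auto simp: cycle_edges_hx)
    then show ?thesis unfolding E by blast
  qed
  moreover have "er a k \<in> edges H" if "a \<le> m" "k < width a" for a k
  proof (cases a)
    case 0
    then have "er a k \<in> cycle_edges (corners (hx a k))" "a < m" "k < r (Suc a)"
      using that m_pos by (auto simp: cycle_edges_hx)
    then show ?thesis unfolding E by blast
  next
    case (Suc b)
    then have "er a k \<in> cycle_edges (corners (hx b k))" "b < m" "k < r (Suc b)"
      using that by (auto simp: cycle_edges_hx)
    then show ?thesis unfolding E by blast
  qed
  moreover have "ev a k \<in> edges H" if "a < m" "k \<le> r (Suc a)" for a k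
  proof (cases k)
    case 0
    then have "ev a k \<in> cycle_edges (corners (hx a k))" "k < r (Suc a)"
      using that r_pos[of a] by (auto simp: cycle_edges_hx)
    then show ?thesis using that unfolding E by blast
  next
    case (Suc l)
    then have "ev a k \<in> cycle_edges (corners (hx a l))" "l < r (Suc a)"
      using that by (auto simp: cycle_edges_hx)
    then show ?thesis using that unfolding E by blast
  qed
  ultimately show ?thesis
    by (intro equalityI) (assumption, (intro Un_least subsetI; elim CollectE exE conjE; simp))
qed

lemma edge_in_H [simp]:
  "el a k \<in> edges H \<longleftrightarrow> a \<le> m \<and> k \<le> width a \<and> (a = 0 \<longrightarrow> k < width a) \<and> (a = m \<longrightarrow> 0 < k)"
  "er a k \<in> edges H \<longleftrightarrow> a \<le> m \<and> k < width a"
  "ev a k \<in> edges H \<longleftrightarrow> a < m \<and> k \<le> r (Suc a)"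
  by (auto simp: edges_H)

lemma verts_H_Union: "verts H = \<Union> (edges H)"
proof -
  have "set (corners c) = \<Union> (cycle_edges (corners c))" for c
    by (rule Union_cycle_edges[symmetric])
  then show ?thesis
    by (auto simp: verts_def edges_def trunc_para_def)
qed

lemma verts_H:
  "verts H = {wv a k | a k. a \<le> m \<and> k \<le> width a \<and> (a = 0 \<longrightarrow> k < width a)} \<union>
     {bv a k | a k. a \<le> m \<and> k \<le> width a \<and> (a = m \<longrightarrow> 0 < k)}" (is "_ = ?R")
proof
  have "e \<subseteq> ?R" if e: "e \<in> edges H" for e
  proof -
    consider a k where "e = el a k" "el a k \<in> edges H" | a k where "e = er a k" "er a k \<in> edges H"
      | a k where "e = ev a k" "ev a k \<in> edges H"
      using e unfolding edges_H by (elim UnE CollectE exE conjE) (auto simp flip: edges_H)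
    then show ?thesis
    proof cases
      case (3 a k)
      then have "a < m" "k \<le> r (Suc a)" "k \<le> width a" using width_decr[of a] by auto
      with 3(1) show ?thesis by (auto simp: ev_def)
    next
      case (1 a k)
      then have "a \<le> m \<and> k \<le> width a \<and> (a = 0 \<longrightarrow> k < width a) \<and> (a = m \<longrightarrow> 0 < k)" by simp
      with 1(1) show ?thesis by (auto simp: el_def)
    next
      case (2 a k)
      then have "a \<le> m" "k < width a" by simp_all
      with 2(1) show ?thesis by (auto simp: er_def)
    qed
  qed
  then show "verts H \<subseteq> ?R"
    unfolding verts_H_Union by blast
  have "wv a k \<in> verts H" if "a \<le> m" "k \<le> width a" "a = 0 \<longrightarrow> k < width a" for a k
  proof (cases a)
    case 0
    then have "el a k \<in> edges H" "wv a k \<in> el a k" using that m_pos by auto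
    then show ?thesis unfolding verts_H_Union by blast
  next
    case (Suc b)
    then have "ev b k \<in> edges H" "wv a k \<in> ev b k" using that by auto
    then show ?thesis unfolding verts_H_Union by blast
  qed
  moreover have "bv a k \<in> verts H" if "a \<le> m" "k \<le> width a" "a = m \<longrightarrow> 0 < k" for a k
  proof (cases k)
    case 0
    then have "ev a k \<in> edges H" "bv a k \<in> ev a k" using that by auto
    then show ?thesis unfolding verts_H_Union by blast
  next
    case (Suc l)
    then have "er a l \<in> edges H" "bv a k \<in> er a l" using that by auto
    then show ?thesis unfolding verts_H_Union by blast
  qed
  ultimately show "?R \<subseteq> verts H"
    by (intro Un_least subsetI; elim CollectE exE conjE; simp)
qed

lemma vertex_in_H [simp]:
  "wv a k \<in> verts H \<longleftrightarrow> a \<le> m \<and> k \<le> width a \<and> (a = 0 \<longrightarrow> k < width a)"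
  "bv a k \<in> verts H \<longleftrightarrow> a \<le> m \<and> k \<le> width a \<and> (a = m \<longrightarrow> 0 < k)"
  by (auto simp: verts_H)

text \<open>
  \<open>P (Suc a)\<close> is the position of the vertical edge in row \<open>a\<close>. The values \<open>P 0\<close> and \<open>P (Suc m)\<close> are
  the positions of the missing vertices of the two extreme zigzag paths, which can thus be treated like
  the others.
\<close>

definition profiles :: "(nat \<Rightarrow> nat) set" where
  "profiles = {P. antimono P \<and> P 0 = r 1 \<and> (\<forall>a<m. P (Suc a) \<le> r (Suc a)) \<and> (\<forall>a>m. P a = 0)}"

text \<open>On path \<open>a\<close> the white vertex \<open>P a\<close> is taken from below and the
  black vertex \<open>P (Suc a)\<close> from above; the rest follows the pattern of
  \<open>zigzag\<close> with \<open>p = P a\<close> and \<open>q = P (Suc a)\<close>.\<close>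

definition matching :: "(nat \<Rightarrow> nat) \<Rightarrow> pt set set" where
  "matching P = {el a k | a k. a \<le> m \<and> k \<le> width a \<and> (k < P (Suc a) \<or> P a < k)} \<union>
     {er a k | a k. a \<le> m \<and> P (Suc a) \<le> k \<and> k < P a} \<union> {ev a (P (Suc a)) | a. a < m}"

lemma in_matching [simp]:
  "el a k \<in> matching P \<longleftrightarrow> a \<le> m \<and> k \<le> width a \<and> (k < P (Suc a) \<or> P a < k)"
  "er a k \<in> matching P \<longleftrightarrow> a \<le> m \<and> P (Suc a) \<le> k \<and> k < P a"
  "ev a k \<in> matching P \<longleftrightarrow> a < m \<and> k = P (Suc a)"
  by (auto simp: matching_def)

lemma profileD:
  assumes "P \<in> profiles"
  shows "P (Suc a) \<le> P a" "P 0 = r (Suc 0)" "a < m \<Longrightarrow> P (Suc a) \<le> r (Suc a)"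
    "a \<ge> m \<Longrightarrow> P (Suc a) = 0" "a \<le> m \<Longrightarrow> P a \<le> width a"
  using assms by (auto simp: profiles_def antimono_iff_le_Suc width_def Suc_le_eq gr0_conv_Suc)

lemma matching_subset:
  assumes P: "P \<in> profiles"
  shows "matching P \<subseteq> edges H"
proof -
  have "el a k \<in> edges H" if "a \<le> m" "k \<le> width a" "k < P (Suc a) \<or> P a < k" for a k
    using that profileD(1,4)[OF P, of a] profileD(2)[OF P] by (cases "a = 0"; cases "a = m") auto
  moreover have "er a k \<in> edges H" if "a \<le> m" "k < P a" for a k
    using that profileD(5)[OF P, of a] by auto
  moreover have "ev a (P (Suc a)) \<in> edges H" if "a < m" for a
    using that profileD(3)[OF P, of a] by auto
  ultimately show ?thesis
    unfolding matching_def by blast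
qed

lemma matching_perfect:
  assumes P: "P \<in> profiles"
  shows "matching P \<in> perfect_matchings H"
  unfolding perfect_matchings_def
proof (intro CollectI conjI ballI)
  note PD = profileD[OF P]
  show "matching P \<subseteq> edges H" by (rule matching_subset[OF P])
  fix v assume "v \<in> verts H"
  then consider (w) a k where "v = wv a k" "a \<le> m" "k \<le> width a" "a = 0 \<longrightarrow> k < width a"
    | (b) a k where "v = bv a k" "a \<le> m" "k \<le> width a" "a = m \<longrightarrow> 0 < k"
    by (auto simp: verts_H)
  then show "\<exists>!e. e \<in> matching P \<and> v \<in> e"
  proof cases
    case w
    \<comment> \<open>The position of \<open>k\<close> relative to \<open>P (Suc a)\<close> and
      \<open>P a\<close> dictates the edge at \<open>v\<close>. The last branch means
      \<open>k = P a\<close>; this excludes \<open>a = 0\<close>, where \<open>P 0\<close> is the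
      missing vertex, so \<open>a - 1\<close> is a true predecessor.\<close>
    have *: "e = (if k < P (Suc a) \<or> P a < k then el a k else if k < P a then er a k else ev (a - 1) k)"
      if "e \<in> matching P" "v \<in> e" for e
      using that w PD(1)[of a] by (auto simp: matching_def)
    have "(if k < P (Suc a) \<or> P a < k then el a k else if k < P a then er a k else ev (a - 1) k) \<in> matching P"
      using w PD(1)[of a] PD(2) by (cases a) auto
    moreover have "v \<in> (if k < P (Suc a) \<or> P a < k then el a k else if k < P a then er a k else ev (a - 1) k)"
      using w PD(1)[of a] PD(2) by (cases a) auto
    ultimately show ?thesis using * by blast
  next
    case b
    have *: "e = (if k < P (Suc a) \<or> P a < k then el a k else if P (Suc a) < k then er a (k - 1) else ev a k)"
      if "e \<in> matching P" "v \<in> e" for e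
      using that b PD(1)[of a] by (auto simp: matching_def)
    have "(if k < P (Suc a) \<or> P a < k then el a k else if P (Suc a) < k then er a (k - 1) else ev a k) \<in> matching P"
      using b PD(1)[of a] PD(2) PD(4)[of a] by (cases "a = m") auto
    moreover have "v \<in> (if k < P (Suc a) \<or> P a < k then el a k else if P (Suc a) < k then er a (k - 1) else ev a k)"
      using b PD(1)[of a] PD(2) by auto
    ultimately show ?thesis using * by blast
  qed
qed

text \<open>Induction over the zigzag paths from the bottom. If a single white vertex is taken from
  below, \<open>zigzag\<close> leaves a single black vertex, which must be matched upwards and so
  takes a single white vertex of the next path.\<close>

lemma perfect_matching_profile:
  assumes M: "M \<in> perfect_matchings H"
  obtains P where "P \<in> profiles" "M = matching P"
proof -
  have ME: "M \<subseteq> edges H" and ex1: "\<And>v. v \<in> verts H \<Longrightarrow> \<exists>!e. e \<in> M \<and> v \<in> e"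
    using M by (auto simp: perfect_matchings_def)
  define P where "P a = (case a of 0 \<Rightarrow> r 1 | Suc b \<Rightarrow> if b < m then THE k. ev b k \<in> M else 0)" for a
  have P0: "P 0 = r (Suc 0)" by (simp add: P_def)
  have uniq: "e = f" if "v \<in> e" "v \<in> f" "e \<in> M" "f \<in> M" for v e f
    using ex1[of v] that ME unfolding verts_H_Union by blast
  have excl: "\<not> (el a k \<in> M \<and> er a k \<in> M)" "\<not> (er a k \<in> M \<and> el a (Suc k) \<in> M)"
     "\<not> (el (Suc a) k \<in> M \<and> ev a k \<in> M)" "\<not> (er (Suc a) k \<in> M \<and> ev a k \<in> M)"
     "\<not> (el a k \<in> M \<and> ev a k \<in> M)" "\<not> (er a k \<in> M \<and> ev a (Suc k) \<in> M)" for a k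
    using uniq[of "wv a k" "el a k" "er a k"] uniq[of "bv a (Suc k)" "er a k" "el a (Suc k)"]
      uniq[of "wv (Suc a) k" "el (Suc a) k" "ev a k"] uniq[of "wv (Suc a) k" "er (Suc a) k" "ev a k"]
      uniq[of "bv a k" "el a k" "ev a k"] uniq[of "bv a (Suc k)" "er a k" "ev a (Suc k)"]
    by auto
  have cov_w: "el a k \<in> M \<or> er a k \<in> M \<or> (\<exists>b. a = Suc b \<and> ev b k \<in> M)" if v: "wv a k \<in> verts H" for a k
  proof -
    obtain e where e: "e \<in> M" "wv a k \<in> e" using ex1[OF v] by blast
    then have "e \<in> edges H" using ME by blast
    with e show ?thesis unfolding edges_H by auto
  qed
  have cov_b: "el a k \<in> M \<or> (\<exists>l. k = Suc l \<and> er a l \<in> M) \<or> ev a k \<in> M" if v: "bv a k \<in> verts H" for a k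
  proof -
    obtain e where e: "e \<in> M" "bv a k \<in> e" using ex1[OF v] by blast
    then have "e \<in> edges H" using ME by blast
    with e show ?thesis unfolding edges_H by auto
  qed
  have inH: "el a k \<in> M \<Longrightarrow> el a k \<in> edges H" "er a k \<in> M \<Longrightarrow> er a k \<in> edges H"
    "ev a k \<in> M \<Longrightarrow> ev a k \<in> edges H" for a k
    using ME by auto
  \<comment> \<open>By \<open>Pa\<close>, exactly the vertical edge at \<open>P a\<close> arrives
    from below; for \<open>a = 0\<close> it is void, and \<open>P 0 = r 1\<close> is the missing
    white vertex.\<close>
  have step: "P (Suc a) \<le> P a \<and> (\<forall>k\<le>width a. el a k \<in> M \<longleftrightarrow> k < P (Suc a) \<or> P a < k) \<and>
      (\<forall>k\<le>width a. er a k \<in> M \<longleftrightarrow> P (Suc a) \<le> k \<and> k < P a) \<and> (a < m \<longrightarrow> (\<forall>k. ev a k \<in> M \<longleftrightarrow> k = P (Suc a)))"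
    if a: "a \<le> m" and Pa: "\<And>b k. a = Suc b \<Longrightarrow> ev b k \<in> M \<longleftrightarrow> k = P a" for a
  proof -
    have *: "P a \<le> width a" "\<not> el a (P a) \<in> M" "\<not> er a (P a) \<in> M"
    proof -
      show "P a \<le> width a"
        using inH(3)[of "a - 1" "P a"] Pa[of "a - 1" "P a"] P0 by (cases a) auto
      show "\<not> el a (P a) \<in> M"
        using inH(1)[of a "P a"] excl(3)[of "a - 1" "P a"] Pa[of "a - 1" "P a"] P0 by (cases a) auto
      show "\<not> er a (P a) \<in> M"
        using inH(2)[of a "P a"] excl(4)[of "a - 1" "P a"] Pa[of "a - 1" "P a"] P0 by (cases a) auto
    qed
    have **: "(el a k \<in> M) \<noteq> (er a k \<in> M)" if "k \<le> width a" "k \<noteq> P a" for k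
      using cov_w[of a k] excl(1)[of a k] Pa P0 that a by (cases a) auto
    obtain q where q: "q \<le> P a" "\<And>k. k \<le> width a \<Longrightarrow> el a k \<in> M \<longleftrightarrow> k < q \<or> P a < k"
      "\<And>k. k \<le> width a \<Longrightarrow> er a k \<in> M \<longleftrightarrow> q \<le> k \<and> k < P a"
      using zigzag[of "P a" "width a" "\<lambda>k. el a k \<in> M" "\<lambda>k. er a k \<in> M"] * ** inH(2)[of a "width a"] excl(2)
      by auto
    show ?thesis
    proof (cases "a = m")
      case True
      \<comment> \<open>On the highest path the black vertex \<open>0\<close> is missing, so
        \<open>el m 0\<close> is no edge; this forces \<open>q = 0\<close>, the default value of
        \<open>P (Suc m)\<close>.\<close>
      then have "q = 0"
        using q(2)[of 0] inH(1)[of a 0] by auto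
      then show ?thesis using q True by (auto simp: P_def)
    next
      case False
      \<comment> \<open>Every black vertex of the path other than \<open>q\<close> is matched within
        the path, and \<open>q\<close> is not.\<close>
      have evq: "ev a k \<in> M \<longleftrightarrow> k = q" for k
      proof
        assume k: "ev a k \<in> M"
        then have "k \<le> width a" using inH(3)[of a k] width_decr[of a] by auto
        moreover from k have "el a k \<notin> M" using excl(5) by blast
        moreover have "er a (k - 1) \<notin> M" if "0 < k" using k excl(6)[of a "k - 1"] that by auto
        ultimately show "k = q" using q(1) q(2)[of k] q(3)[of "k - 1"] by (cases k) auto
      next
        assume "k = q"
        moreover have "bv a q \<in> verts H" using q(1) * a False by auto
        ultimately show "ev a k \<in> M" using cov_b[of a q] q(1) q(2)[of q] q(3)[of "q - 1"] * by auto
      qed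
      then have "P (Suc a) = q" using a False by (auto simp: P_def)
      then show ?thesis using q evq by blast
    qed
  qed
  have all: "a \<le> m \<Longrightarrow> P (Suc a) \<le> P a \<and> (\<forall>k\<le>width a. el a k \<in> M \<longleftrightarrow> k < P (Suc a) \<or> P a < k) \<and>
      (\<forall>k\<le>width a. er a k \<in> M \<longleftrightarrow> P (Suc a) \<le> k \<and> k < P a) \<and> (a < m \<longrightarrow> (\<forall>k. ev a k \<in> M \<longleftrightarrow> k = P (Suc a)))" for a
  proof (induction a)
    case 0
    then show ?case by (intro step) auto
  next
    case (Suc a)
    then show ?case by (intro step) auto
  qed
  have P_beyond: "P (Suc a) = 0" if "a \<ge> m" for a
    using that by (auto simp: P_def)
  have prof: "P \<in> profiles"
    unfolding profiles_def antimono_iff_le_Suc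
  proof (intro CollectI conjI allI impI)
    show "P (Suc a) \<le> P a" for a
      using all[of a] P_beyond[of a] by (cases "a \<le> m") auto
    show "P (Suc a) \<le> r (Suc a)" if "a < m" for a
      using all[of a] that inH(3)[of a "P (Suc a)"] by auto
    show "P a = 0" if "m < a" for a
      using that P_beyond[of "a - 1"] by auto
  qed (simp add: P0)
  have "e \<in> M \<longleftrightarrow> e \<in> matching P" if "e \<in> edges H" for e
    using that unfolding edges_H using all by auto
  then have "M = matching P"
    using ME matching_subset[OF prof] by blast
  with prof show ?thesis using that by blast
qed

section \<open>Profiles and order ideals\<close>

definition ideal_of :: "(nat \<Rightarrow> nat) \<Rightarrow> pt set" where
  "ideal_of P = {hx a k | a k. a < m \<and> k < P (Suc a)}"

lemma hx_in_ideal_of [simp]: "hx a k \<in> ideal_of P \<longleftrightarrow> a < m \<and> k < P (Suc a)"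
  by (auto simp: ideal_of_def)

lemma ideal_of_mono_iff:
  assumes "P \<in> profiles" "Q \<in> profiles"
  shows "ideal_of P \<subseteq> ideal_of Q \<longleftrightarrow> P \<le> Q"
proof
  assume sub: "ideal_of P \<subseteq> ideal_of Q"
  have "P (Suc a) \<le> Q (Suc a)" for a
  proof (cases "a < m")
    case True
    have "k < Q (Suc a)" if "k < P (Suc a)" for k
      using sub True that hx_in_ideal_of[of a k] by blast
    then show ?thesis by (meson leI less_irrefl)
  qed (use profileD(4)[OF assms(1)] in auto)
  moreover have "P 0 = Q 0" using assms by (simp add: profileD)
  ultimately show "P \<le> Q" by (metis le_fun_def not0_implies_Suc order_refl)
next
  assume "P \<le> Q"
  then show "ideal_of P \<subseteq> ideal_of Q"
    by (fastforce simp: ideal_of_def le_fun_def intro: less_le_trans)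
qed

lemma matching_inject:
  assumes "P \<in> profiles" "Q \<in> profiles" "matching P = matching Q"
  shows "P = Q"
proof
  fix a
  show "P a = Q a"
  proof (cases a)
    case (Suc b)
    then show ?thesis
      using in_matching(3)[of b "P a" P] in_matching(3)[of b "P a" Q] assms
        profileD(4)[of P b] profileD(4)[of Q b]
      by (cases "b < m") auto
  qed (use assms in \<open>simp add: profileD\<close>)
qed

lemma hexagon_le: "snd (hexagon_poset m r) (hx a k) (hx b l) \<longleftrightarrow> a \<le> b \<and> k \<le> l"
proof
  assume "snd (hexagon_poset m r) (hx a k) (hx b l)"
  then show "a \<le> b \<and> k \<le> l"
    by (force simp: hexagon_poset_def hx_def hex_inject)
next
  assume "a \<le> b \<and> k \<le> l"
  then show "snd (hexagon_poset m r) (hx a k) (hx b l)"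
    unfolding hexagon_poset_def hx_def snd_conv
    by (intro exI[of _ "Suc a"] exI[of _ "Suc k"] exI[of _ "Suc b"] exI[of _ "Suc l"]) auto
qed

text \<open>An order ideal meets every row in an initial segment, and the segment lengths decrease
  weakly from row to row, so they form a profile.\<close>

lemma ideals_eq: "fst (ideal_lattice (hexagon_poset m r)) = ideal_of ` profiles"
proof (intro equalityI subsetI)
  fix I assume "I \<in> fst (ideal_lattice (hexagon_poset m r))"
  then have sub: "I \<subseteq> hexagons m r"
    and "\<And>x y. x \<in> I \<Longrightarrow> y \<in> hexagons m r \<Longrightarrow> snd (hexagon_poset m r) y x \<Longrightarrow> y \<in> I"
    by (auto simp: ideal_lattice_def hexagon_poset_def)
  then have down: "hx b l \<in> I" if "hx a k \<in> I" "b \<le> a" "l \<le> k" "b < m" "l < r (Suc b)" for a b k l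
    using that by (auto simp: hexagon_le hx_in_hexagons)
  have inI: "a < m \<and> k < r (Suc a)" if "hx a k \<in> I" for a k
    using that sub hx_in_hexagons by blast
  \<comment> \<open>The first column missing in row \<open>b\<close>, that is, the length of its
    segment; it is \<open>0\<close> for \<open>b \<ge> m\<close>, where \<open>I\<close> has no
    hexagons.\<close>
  define P where "P a = (case a of 0 \<Rightarrow> r 1 | Suc b \<Rightarrow> LEAST k. hx b k \<notin> I)" for a
  have out: "hx a (P (Suc a)) \<notin> I" for a
    unfolding P_def using LeastI[of "\<lambda>k. hx a k \<notin> I" "r (Suc a)"] inI by force
  have le: "P (Suc a) \<le> k" if "hx a k \<notin> I" for a k
    unfolding P_def using that by (simp add: Least_le)
  have iff: "hx a k \<in> I \<longleftrightarrow> k < P (Suc a)" for a k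
  proof
    assume k: "hx a k \<in> I"
    show "k < P (Suc a)"
    proof (rule ccontr)
      assume "\<not> k < P (Suc a)"
      then show False using down[OF k, of a "P (Suc a)"] inI[OF k] out by auto
    qed
  qed (use le in force)
  have "P \<in> profiles"
    unfolding profiles_def antimono_iff_le_Suc
  proof (intro CollectI conjI allI impI)
    show "P (Suc a) \<le> r (Suc a)" for a
      by (rule le) (use inI in blast)
    show "P (Suc a) \<le> P a" for a
    proof (cases a)
      case 0
      have "P (Suc 0) \<le> r (Suc 0)"
        by (rule le) (use inI in blast)
      then show ?thesis by (simp add: P_def 0)
    next
      case (Suc b)
      show ?thesis
        unfolding Suc
      proof (rule le, rule notI)
        \<comment> \<open>A longer segment in row \<open>Suc b\<close> would contain a hexagon in
          the column first missing in row \<open>b\<close>. As rows do not get longer upwards, row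
          \<open>b\<close> has a hexagon in that column, which would then be in
          \<open>I\<close>.\<close>
        assume *: "hx (Suc b) (P (Suc b)) \<in> I"
        then have "Suc b < m" "P (Suc b) < r (Suc (Suc b))" using inI by blast+
        then show False
          using down[OF *, of b "P (Suc b)"] out[of b] width_decr[of "Suc b"] by auto
      qed
    qed
    show "P a = 0" if "m < a" for a
      using that le[of "a - 1" 0] inI[of "a - 1" 0] by fastforce
  qed (simp add: P_def)
  moreover have "I = ideal_of P"
    using sub inI iff by (auto simp: ideal_of_def hexagons_hx)
  ultimately show "I \<in> ideal_of ` profiles" by blast
next
  fix I assume "I \<in> ideal_of ` profiles"
  then obtain P where P: "P \<in> profiles" and I: "I = ideal_of P" by blast
  have "I \<subseteq> hexagons m r"
    using profileD(3)[OF P] by (fastforce simp: I ideal_of_def hexagons_hx)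
  moreover have "y \<in> I" if x': "x \<in> I" and y': "y \<in> hexagons m r" and le: "snd (hexagon_poset m r) y x" for x y
  proof -
    obtain a k where x: "x = hx a k" "a < m" "k < P (Suc a)"
      using x' by (auto simp: I ideal_of_def)
    obtain b l where y: "y = hx b l" "b < m"
      using y' by (auto simp: hexagons_hx)
    have "b \<le> a" "l \<le> k" using le by (auto simp: x y hexagon_le)
    then have "P (Suc a) \<le> P (Suc b)"
      using P by (auto simp: profiles_def intro: antimonoD)
    then show ?thesis using x y \<open>l \<le> k\<close> by (simp add: I)
  qed
  ultimately show "I \<in> fst (ideal_lattice (hexagon_poset m r))"
    by (auto simp: ideal_lattice_def hexagon_poset_def)
qed

end

section \<open>Inner faces\<close>

text \<open>\<open>hu\<close> and \<open>hv\<close> are the lattice coordinates, inverse to \<open>pos\<close>.\<close>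

definition hu :: "real \<times> real \<Rightarrow> real" where
  "hu z = 2 / sqrt 3 * fst z"

definition hv :: "real \<times> real \<Rightarrow> real" where
  "hv z = 2 * snd z"

lemma hu_hv_pos [simp]: "hu (pos p) = real_of_int (fst p)" "hv (pos p) = real_of_int (snd p)"
  by (simp_all add: hu_def hv_def pos_def)

lemma hu_hv_eq_iff: "z = z' \<longleftrightarrow> hu z = hu z' \<and> hv z = hv z'"
  by (auto simp: hu_def hv_def prod_eq_iff)

lemma hu_hv_affine:
  "hu ((1 - t) *\<^sub>R z + t *\<^sub>R z') = (1 - t) * hu z + t * hu z'"
  "hv ((1 - t) *\<^sub>R z + t *\<^sub>R z') = (1 - t) * hv z + t * hv z'"
  by (simp_all add: hu_def hv_def algebra_simps add_divide_distrib diff_divide_distrib)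

lemma continuous_on_hu_hv [continuous_intros]: "continuous_on A hu" "continuous_on A hv"
  unfolding hu_def hv_def by (auto intro!: continuous_intros)

lemma in_segment_hu_hv:
  "z \<in> closed_segment z1 z2 \<longleftrightarrow>
     (\<exists>t. 0 \<le> t \<and> t \<le> 1 \<and> hu z = (1 - t) * hu z1 + t * hu z2 \<and> hv z = (1 - t) * hv z1 + t * hv z2)"
  by (auto simp: in_segment hu_hv_eq_iff hu_hv_affine)

lemma in_draw_iff: "z \<in> draw E \<longleftrightarrow> (\<exists>e\<in>E. z \<in> convex hull (pos ` e))"
  by (auto simp: draw_def)

lemma hull_edge: "convex hull (pos ` {p, q}) = closed_segment (pos p) (pos q)"
  by (simp add: segment_convex_hull)

text \<open>The closed hexagonal region around \<open>c\<close>: the first inequality comes from the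
  vertical sides, the second from the four slanted ones. \<open>hexo\<close> is the open
  region.\<close>

definition hexc :: "pt \<Rightarrow> (real \<times> real) set" where
  "hexc c = {z. \<bar>hu z - fst c\<bar> \<le> 1 \<and> \<bar>hu z - fst c\<bar> + \<bar>hv z - snd c\<bar> \<le> 2}"

definition hexo :: "pt \<Rightarrow> (real \<times> real) set" where
  "hexo c = {z. \<bar>hu z - fst c\<bar> < 1 \<and> \<bar>hu z - fst c\<bar> + \<bar>hv z - snd c\<bar> < 2}"

lemma pos_in_hexo: "pos c \<in> hexo c"
  by (simp add: hexo_def)

lemma hexo_subset_hexc: "hexo c \<subseteq> hexc c"
  by (auto simp: hexo_def hexc_def)

lemma open_hexo: "open (hexo c)"
  unfolding hexo_def by (intro open_Collect_conj open_Collect_less continuous_intros)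

lemma closed_hexc: "closed (hexc c)"
  unfolding hexc_def by (intro closed_Collect_conj closed_Collect_le continuous_intros)

lemma bounded_hexc: "bounded (hexc c)"
  unfolding bounded_iff
proof (intro exI ballI)
  fix z assume "z \<in> hexc c"
  then have "\<bar>hu z\<bar> \<le> \<bar>fst c\<bar> + 1" "\<bar>hv z\<bar> \<le> \<bar>snd c\<bar> + 2"
    unfolding hexc_def mem_Collect_eq by linarith+
  moreover have "\<bar>fst z\<bar> = sqrt 3 / 2 * \<bar>hu z\<bar>" "\<bar>snd z\<bar> = \<bar>hv z\<bar> / 2"
    by (simp_all add: hu_def hv_def abs_mult)
  ultimately have "\<bar>fst z\<bar> \<le> sqrt 3 / 2 * (\<bar>fst c\<bar> + 1)" "\<bar>snd z\<bar> \<le> (\<bar>snd c\<bar> + 2) / 2"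
    by (auto simp: abs_mult simp del: mult_le_cancel_left_pos intro!: mult_left_mono)
  then show "norm z \<le> sqrt 3 / 2 * (\<bar>fst c\<bar> + 1) + (\<bar>snd c\<bar> + 2) / 2"
    using norm_Pair_le[of "fst z" "snd z"] unfolding prod.collapse real_norm_def by linarith
qed

text \<open>The convexity of hexagons is only needed in this form, as star-shapedness about the centre.\<close>

lemma hexc_star:
  assumes "z \<in> hexc c" "z' \<in> closed_segment (pos c) z" "z' \<noteq> z"
  shows "z' \<in> hexo c"
proof -
  obtain t where t: "0 \<le> t" "t \<le> 1" and z': "z' = (1 - t) *\<^sub>R pos c + t *\<^sub>R z"
    using assms(2) by (auto simp: in_segment)
  have "t \<noteq> 1" using z' assms(3) by auto
  then have "t < 1" using t by simp
  have "hu z' - fst c = t * (hu z - fst c)" "hv z' - snd c = t * (hv z - snd c)"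
    unfolding z' hu_hv_affine by (auto simp: algebra_simps)
  then have *: "\<bar>hu z' - fst c\<bar> = t * \<bar>hu z - fst c\<bar>" "\<bar>hv z' - snd c\<bar> = t * \<bar>hv z - snd c\<bar>"
    using t by (auto simp: abs_mult)
  have "t * \<bar>hu z - fst c\<bar> \<le> t * 1" "t * (\<bar>hu z - fst c\<bar> + \<bar>hv z - snd c\<bar>) \<le> t * 2"
    using assms(1) t by (intro mult_left_mono; simp add: hexc_def)+
  then show ?thesis
    using \<open>t < 1\<close> unfolding hexo_def mem_Collect_eq * by (auto simp: algebra_simps)
qed

lemma connected_hexo: "connected (hexo c)"
proof (rule starlike_imp_connected)
  have "closed_segment (pos c) z \<subseteq> hexo c" if "z \<in> hexo c" for z
    using that hexc_star[of z c] hexo_subset_hexc[of c] by blast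
  then show "starlike (hexo c)"
    unfolding starlike_def using pos_in_hexo by blast
qed

lemma closure_hexo: "closure (hexo c) = hexc c"
proof
  show "closure (hexo c) \<subseteq> hexc c"
    by (intro closure_minimal hexo_subset_hexc closed_hexc)
  show "hexc c \<subseteq> closure (hexo c)"
  proof
    fix z assume z: "z \<in> hexc c"
    show "z \<in> closure (hexo c)"
    proof (cases "z = pos c")
      case True
      then show ?thesis using pos_in_hexo closure_subset by blast
    next
      case False
      have "open_segment (pos c) z \<subseteq> hexo c"
        using hexc_star[OF z] by (auto simp: open_segment_def)
      then have "closure (open_segment (pos c) z) \<subseteq> closure (hexo c)"
        by (rule closure_mono)
      then show ?thesis using False by (auto simp: closure_open_segment)
    qed
  qed
qed

lemma frontier_hexo: "frontier (hexo c) = hexc c - hexo c"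
  by (simp add: frontier_def closure_hexo interior_open open_hexo)

lemma draw_corners: "draw (cycle_edges (corners c)) = hexc c - hexo c"
proof -
  obtain x y where c: "c = (x, y)" by (cases c)
  have in_draw: "z \<in> draw (cycle_edges (corners c)) \<longleftrightarrow>
     z \<in> closed_segment (pos (x, y + 2)) (pos (x + 1, y + 1)) \<or>
     z \<in> closed_segment (pos (x + 1, y + 1)) (pos (x + 1, y - 1)) \<or>
     z \<in> closed_segment (pos (x + 1, y - 1)) (pos (x, y - 2)) \<or>
     z \<in> closed_segment (pos (x, y - 2)) (pos (x - 1, y - 1)) \<or>
     z \<in> closed_segment (pos (x - 1, y - 1)) (pos (x - 1, y + 1)) \<or>
     z \<in> closed_segment (pos (x - 1, y + 1)) (pos (x, y + 2))" for z
    unfolding c cycle_edges_corners draw_def by (simp only: UN_insert UN_empty Un_iff hull_edge empty_iff simp_thms)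
  show ?thesis
  proof (intro equalityI subsetI)
    fix z assume "z \<in> draw (cycle_edges (corners c))"
    then show "z \<in> hexc c - hexo c"
      unfolding in_draw in_segment_hu_hv unfolding hexc_def hexo_def c
      by (elim disjE exE conjE) (auto simp: algebra_simps abs_if)
  next
    fix z assume z: "z \<in> hexc c - hexo c"
    define u v where "u = hu z - x" and "v = hv z - y"
    have uv: "hu z = x + u" "hv z = y + v" by (auto simp: u_def v_def)
    have "\<bar>u\<bar> \<le> 1" "\<bar>u\<bar> + \<bar>v\<bar> \<le> 2" "\<bar>u\<bar> = 1 \<or> \<bar>u\<bar> + \<bar>v\<bar> = 2"
      using z by (auto simp: hexc_def hexo_def c u_def v_def)
    then consider "u = 1" "\<bar>v\<bar> \<le> 1" | "u = -1" "\<bar>v\<bar> \<le> 1"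
      | "0 \<le> u" "u \<le> 1" "v = 2 - u" | "0 \<le> u" "u \<le> 1" "v = u - 2"
      | "- 1 \<le> u" "u \<le> 0" "v = 2 + u" | "- 1 \<le> u" "u \<le> 0" "v = - 2 - u"
      by linarith
    then show "z \<in> draw (cycle_edges (corners c))"
    proof cases
      case 1
      then have "z \<in> closed_segment (pos (x + 1, y + 1)) (pos (x + 1, y - 1))"
        unfolding in_segment_hu_hv by (intro exI[of _ "(1 - v) / 2"]) (auto simp: uv field_simps)
      then show ?thesis unfolding in_draw by blast
    next
      case 2
      then have "z \<in> closed_segment (pos (x - 1, y - 1)) (pos (x - 1, y + 1))"
        unfolding in_segment_hu_hv by (intro exI[of _ "(1 + v) / 2"]) (auto simp: uv field_simps)
      then show ?thesis unfolding in_draw by blast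
    next
      case 3
      then have "z \<in> closed_segment (pos (x, y + 2)) (pos (x + 1, y + 1))"
        unfolding in_segment_hu_hv by (intro exI[of _ u]) (auto simp: uv algebra_simps)
      then show ?thesis unfolding in_draw by blast
    next
      case 4
      then have "z \<in> closed_segment (pos (x + 1, y - 1)) (pos (x, y - 2))"
        unfolding in_segment_hu_hv by (intro exI[of _ "1 - u"]) (auto simp: uv algebra_simps)
      then show ?thesis unfolding in_draw by blast
    next
      case 5
      then have "z \<in> closed_segment (pos (x - 1, y + 1)) (pos (x, y + 2))"
        unfolding in_segment_hu_hv by (intro exI[of _ "1 + u"]) (auto simp: uv algebra_simps)
      then show ?thesis unfolding in_draw by blast
    next
      case 6
      then have "z \<in> closed_segment (pos (x, y - 2)) (pos (x - 1, y - 1))"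
        unfolding in_segment_hu_hv by (intro exI[of _ "- u"]) (auto simp: uv algebra_simps)
      then show ?thesis unfolding in_draw by blast
    qed
  qed
qed

text \<open>\<open>hx\<close> extended to integer indices, so that hexagons of the tiling to the
  left of \<open>H\<close> or below it are included.\<close>

definition lattice_centre :: "int \<Rightarrow> int \<Rightarrow> pt" where
  "lattice_centre a b = (2 * b - a, 3 * a)"

lemma lattice_tiling: "\<exists>a b. z \<in> hexc (lattice_centre a b)"
proof -
  \<comment> \<open>Boxes of width 2 and height 3, reaching from 1 below to 2 above each centre,
    partition the plane; rounding finds the box of \<open>z\<close>.\<close>
  define a where "a = \<lfloor>(hv z + 1) / 3\<rfloor>"
  have a: "3 * real_of_int a - 1 \<le> hv z" "hv z < 3 * real_of_int a + 2"
    using floor_correct[of "(hv z + 1) / 3"] unfolding a_def[symmetric] by (auto simp: field_simps)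
  define b where "b = \<lfloor>(hu z + a + 1) / 2\<rfloor>"
  have b: "2 * real_of_int b - a - 1 \<le> hu z" "hu z < 2 * real_of_int b - a + 1"
    using floor_correct[of "(hu z + a + 1) / 2"] unfolding b_def[symmetric] by (auto simp: field_simps)
  define u v where "u = hu z - (2 * real_of_int b - a)" and "v = hv z - 3 * real_of_int a"
  have uv: "\<bar>u\<bar> \<le> 1" "- 1 \<le> v" "v < 2"
    using a b unfolding u_def v_def by linarith+
  \<comment> \<open>The part of the box outside its own hexagon lies in its two upper corners, which
    belong to the upper right and upper left neighbours.\<close>
  consider "\<bar>u\<bar> + \<bar>v\<bar> \<le> 2" | "2 < \<bar>u\<bar> + \<bar>v\<bar>" "0 < u" | "2 < \<bar>u\<bar> + \<bar>v\<bar>" "u \<le> 0"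
    by linarith
  then show ?thesis
  proof cases
    case 1
    then have "z \<in> hexc (lattice_centre a b)"
      using uv unfolding hexc_def lattice_centre_def u_def v_def by simp
    then show ?thesis by blast
  next
    case 2
    then have "\<bar>u - 1\<bar> \<le> 1 \<and> \<bar>u - 1\<bar> + \<bar>v - 3\<bar> \<le> 2"
      using uv by linarith
    then have "z \<in> hexc (lattice_centre (a + 1) (b + 1))"
      unfolding hexc_def lattice_centre_def u_def v_def by (simp add: algebra_simps)
    then show ?thesis by blast
  next
    case 3
    then have "\<bar>u + 1\<bar> \<le> 1 \<and> \<bar>u + 1\<bar> + \<bar>v - 3\<bar> \<le> 2"
      using uv by linarith
    then have "z \<in> hexc (lattice_centre (a + 1) b)"
      unfolding hexc_def lattice_centre_def u_def v_def by (simp add: algebra_simps)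
    then show ?thesis by blast
  qed
qed

text \<open>By the triangle inequality the centres differ by less than 2 in \<open>hu\<close> and by
  less than 4 in both coordinates together. Rows are 3 apart and consecutive ones are shifted by an
  odd amount, so parity leaves only equal centres.\<close>

lemma hexo_Int_hexc:
  assumes "z \<in> hexo (lattice_centre a b)" "z \<in> hexc (lattice_centre a' b')"
  shows "a = a' \<and> b = b'"
proof -
  define x x' where "x = 2 * b - a" and "x' = 2 * b' - a'"
  have "\<bar>hu z - x\<bar> < 1" "\<bar>hu z - x\<bar> + \<bar>hv z - 3 * a\<bar> < 2"
    "\<bar>hu z - x'\<bar> \<le> 1" "\<bar>hu z - x'\<bar> + \<bar>hv z - 3 * a'\<bar> \<le> 2"
    using assms by (simp_all add: hexo_def hexc_def lattice_centre_def x_def x'_def)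
  then have "\<bar>real_of_int x - x'\<bar> < 2" "\<bar>real_of_int x - x'\<bar> + \<bar>3 * real_of_int a - 3 * a'\<bar> < 4"
    by linarith+
  then have "\<bar>x - x'\<bar> < 2" "\<bar>x - x'\<bar> + \<bar>3 * a - 3 * a'\<bar> < 4"
    by linarith+
  then show ?thesis
    unfolding x_def x'_def by presburger
qed

lemma hx_lattice_centre: "hx a k = lattice_centre (int a) (int k)"
  by (simp add: hx_eq lattice_centre_def)

context truncated_parallelogram
begin

lemma draw_H: "draw (edges H) = (\<Union>c\<in>hexagons m r. hexc c - hexo c)"
proof -
  have "draw (edges H) = (\<Union>c\<in>hexagons m r. draw (cycle_edges (corners c)))"
    by (auto simp: draw_def edges_def trunc_para_def)
  then show ?thesis by (simp add: draw_corners)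
qed

lemma pos_verts_subset: "pos ` verts H \<subseteq> draw (edges H)"
  unfolding verts_H_Union draw_def using hull_subset[of "pos ` _" convex] by blast

lemma inner_faces_H: "inner_faces H = hexo ` hexagons m r"
proof -
  define D where "D = - draw (edges H)"
  have faces: "inner_faces H = {f \<in> components D. bounded f}"
    unfolding inner_faces_def D_def using pos_verts_subset by (simp add: sup_absorb2)
  have hexo_D: "hexo (lattice_centre a b) \<subseteq> D" for a b
  proof
    fix z assume z: "z \<in> hexo (lattice_centre a b)"
    show "z \<in> D"
    proof (rule ccontr)
      assume "z \<notin> D"
      then obtain i k where "z \<in> hexc (hx i k) - hexo (hx i k)"
        unfolding D_def draw_H hexagons_hx by blast
      then show False
        using hexo_Int_hexc[OF z, of "int i" "int k"] z by (auto simp: hx_lattice_centre)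
    qed
  qed
  \<comment> \<open>The face contains the connected set \<open>hexo c\<close> and cannot leave it,
    since the frontier belongs to the drawing of \<open>H\<close>.\<close>
  have hexo_face: "f = hexo c" if f: "f \<in> components D" and c: "c \<in> hexagons m r" "pos c \<in> f" for f c
  proof
    obtain i k where "c = hx i k" using c(1) by (auto simp: hexagons_hx)
    then have "hexo c \<subseteq> D" using hexo_D by (simp add: hx_lattice_centre)
    then show "hexo c \<subseteq> f"
      using components_maximal[OF f connected_hexo, of c] c(2) pos_in_hexo by blast
    have "f \<inter> frontier (hexo c) = {}"
      using in_components_subset[OF f] c(1) unfolding frontier_hexo D_def draw_H by blast
    then show "f \<subseteq> hexo c"
      using connected_Int_frontier[OF in_components_connected[OF f], of "hexo c"] c(2) pos_in_hexo by blast
  qed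
  show ?thesis
  proof (intro equalityI subsetI)
    fix f assume "f \<in> inner_faces H"
    then have f: "f \<in> components D" and bf: "bounded f" by (auto simp: faces)
    obtain z where z: "z \<in> f" using in_components_nonempty[OF f] by blast
    obtain a b where ab: "z \<in> hexc (lattice_centre a b)" using lattice_tiling by blast
    define c where "c = lattice_centre a b"
    have "closed_segment (pos c) z \<subseteq> D"
      using hexc_star[OF ab[folded c_def]] hexo_D[of a b] z in_components_subset[OF f]
      unfolding c_def by blast
    then have "closed_segment (pos c) z \<subseteq> f"
      using components_maximal[OF f, of "closed_segment (pos c) z"] z by auto
    then have cf: "pos c \<in> f" by auto
    have "c \<in> hexagons m r"
    proof (rule ccontr)
      assume c: "c \<notin> hexagons m r"
      \<comment> \<open>In a row of \<open>H\<close>, a hexagon not in \<open>H\<close> lies past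
        the right end or has \<open>b < 0\<close>; the ray goes right in the first case and left in
        the second. In other rows it meets no hexagon of \<open>H\<close> either way.\<close>
      define \<sigma> :: real where "\<sigma> = (if 0 \<le> b then 1 else - 1)"
      define g where "g t = (sqrt 3 / 2 * (2 * b - a + \<sigma> * t), real_of_int (3 * a) / 2)" for t
      have hug: "hu (g t) = 2 * b - a + \<sigma> * t" "hv (g t) = 3 * a" for t
        by (simp_all add: g_def hu_def hv_def)
      have gD: "g t \<in> D" if t: "0 \<le> t" for t
      proof (rule ccontr)
        assume "g t \<notin> D"
        then obtain i k where ik: "i < m" "k < r (Suc i)" "g t \<in> hexc (hx i k)"
          unfolding D_def draw_H hexagons_hx by blast
        then have *: "\<bar>2 * real_of_int b - a + \<sigma> * t - (2 * real k - real i)\<bar> \<le> 1"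
          "\<bar>3 * real_of_int a - 3 * real i\<bar> \<le> 2"
          by (auto simp: hexc_def hug hx_eq)
        have "\<bar>3 * a - 3 * int i\<bar> \<le> 2" using *(2) by linarith
        then have ai: "a = int i" by linarith
        show False
        proof (cases "0 \<le> b")
          case True
          then have "c = hx i (nat b)" by (simp add: c_def ai hx_lattice_centre)
          then have "\<not> nat b < r (Suc i)" using c ik(1) hx_in_hexagons by blast
          then have "int k + 1 \<le> b" using ik(2) True by linarith
          then have "real k + 1 \<le> real_of_int b" by linarith
          then show False using *(1) True t ai by (simp add: \<sigma>_def)
        next
          case False
          then have "b + 1 \<le> 0" by simp
          then have "real_of_int b + 1 \<le> 0" by linarith
          then show False using *(1) False t ai by (simp add: \<sigma>_def)
        qed
      qed
      have "continuous_on {0..} g"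
        unfolding g_def by (intro continuous_intros)
      then have "connected (g ` {0..})"
        by (intro connected_continuous_image) auto
      moreover have "g ` {0..} \<subseteq> D" using gD by auto
      moreover have "g 0 = pos c"
        by (simp add: g_def pos_def c_def lattice_centre_def)
      then have "f \<inter> g ` {0..} \<noteq> {}" using cf by force
      ultimately have gf: "g ` {0..} \<subseteq> f"
        using components_maximal[OF f] by blast
      obtain K where K: "\<And>z. z \<in> f \<Longrightarrow> norm z \<le> K"
        using bf unfolding bounded_iff by blast
      \<comment> \<open>Far enough that \<open>hu (g t)\<close> exceeds
        \<open>2 * \<bar>K\<bar>\<close> in absolute value; the factor \<open>sqrt 3 / 2\<close> is
        at least \<open>1 / 2\<close>.\<close>
      define t where "t = 2 * \<bar>K\<bar> + \<bar>2 * real_of_int b - a\<bar> + 1"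
      have "norm (fst (g t)) \<le> norm (g t)" using norm_fst_le[of "fst (g t)" "snd (g t)"] by simp
      also have "\<dots> \<le> K" by (rule K, rule subsetD[OF gf]) (simp add: t_def)
      finally have "sqrt 3 / 2 * \<bar>2 * b - a + \<sigma> * t\<bar> \<le> K"
        by (simp add: g_def abs_mult)
      moreover have "2 * \<bar>K\<bar> + 1 \<le> \<bar>2 * b - a + \<sigma> * t\<bar>"
        unfolding \<sigma>_def t_def by auto
      then have "1 / 2 * (2 * \<bar>K\<bar> + 1) \<le> sqrt 3 / 2 * \<bar>2 * b - a + \<sigma> * t\<bar>"
        by (intro mult_mono) auto
      ultimately have "1 / 2 * (2 * \<bar>K\<bar> + 1) \<le> K"
        by linarith
      then show False by simp
    qed
    with hexo_face[OF f _ cf] show "f \<in> hexo ` hexagons m r" by blast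
  next
    fix f assume "f \<in> hexo ` hexagons m r"
    then obtain c where c: "c \<in> hexagons m r" "f = hexo c" by blast
    obtain i k where "c = hx i k" using c(1) by (auto simp: hexagons_hx)
    then have "pos c \<in> D" using hexo_D pos_in_hexo[of c] by (auto simp: hx_lattice_centre)
    then obtain f' where f': "f' \<in> components D" "pos c \<in> f'"
      using Union_components by blast
    then have "f' = f" using hexo_face c by blast
    moreover have "bounded f"
      using bounded_subset[OF bounded_hexc hexo_subset_hexc] c(2) by blast
    ultimately show "f \<in> inner_faces H" using f' by (simp add: faces)
  qed
qed

end

section \<open>Arcs of the Z-transformation digraph\<close>

lemma in_hull_edge:
  "z \<in> convex hull (pos ` el a k) \<longleftrightarrow>
     (\<exists>t. 0 \<le> t \<and> t \<le> 1 \<and> hu z = 2 * real k - real a - t \<and> hv z = 3 * real a - 2 + t)"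
  "z \<in> convex hull (pos ` er a k) \<longleftrightarrow>
     (\<exists>t. 0 \<le> t \<and> t \<le> 1 \<and> hu z = 2 * real k - real a + t \<and> hv z = 3 * real a - 2 + t)"
  "z \<in> convex hull (pos ` ev a k) \<longleftrightarrow>
     (\<exists>t. 0 \<le> t \<and> t \<le> 1 \<and> hu z = 2 * real k - real a - 1 \<and> hv z = 3 * real a + 1 - 2 * t)"
  unfolding el_def er_def ev_def hull_edge in_segment_hu_hv
  by (intro arg_cong[where f = Ex] ext; auto simp: wv_def bv_def algebra_simps)+

lemma nat_eq_of_real:
  fixes a b :: nat
  assumes "real a < real b + 1" "real b < real a + 1"
  shows "a = b"
  using assms by linarith

definition lattice_edges :: "pt set set" where
  "lattice_edges = {e. \<exists>a k. e = el a k \<or> e = er a k \<or> e = ev a k}"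

text \<open>The witness is the midpoint of the edge.\<close>

lemma lattice_edge_witness:
  assumes "e \<in> lattice_edges"
  obtains z where "z \<in> convex hull (pos ` e)"
    "\<And>e'. e' \<in> lattice_edges \<Longrightarrow> z \<in> convex hull (pos ` e') \<Longrightarrow> e' = e"
proof -
  have pt: "\<exists>z. hu z = u \<and> hv z = v" for u v
    by (rule exI[of _ "(sqrt 3 / 2 * u, v / 2)"]) (simp add: hu_def hv_def)
  from assms consider (l) a k where "e = el a k" | (r) a k where "e = er a k" | (v) a k where "e = ev a k"
    by (auto simp: lattice_edges_def)
  then show ?thesis
  proof cases
    case l
    obtain z where z: "hu z = 2 * real k - real a - 1 / 2" "hv z = 3 * real a - 3 / 2" using pt by blast
    show ?thesis
    proof
      show "z \<in> convex hull (pos ` e)"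
        unfolding l in_hull_edge by (intro exI[of _ "1 / 2"]) (simp add: z)
      fix e' assume e': "e' \<in> lattice_edges" "z \<in> convex hull (pos ` e')"
      from e'(1) consider b j where "e' = el b j" | b j where "e' = er b j" | b j where "e' = ev b j"
        by (auto simp: lattice_edges_def)
      then show "e' = e"
      proof cases
        case 1
        obtain t where t: "0 \<le> t" "t \<le> 1" "hu z = 2 * real j - real b - t" "hv z = 3 * real b - 2 + t"
          using e'(2) unfolding 1 in_hull_edge by blast
        have "a = b" using t z by (intro nat_eq_of_real) linarith+
        moreover have "k = j" using t z \<open>a = b\<close> by (intro nat_eq_of_real) linarith+
        ultimately show ?thesis by (simp add: 1 l)
      next
        case 2
        obtain t where t: "0 \<le> t" "t \<le> 1" "hu z = 2 * real j - real b + t" "hv z = 3 * real b - 2 + t"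
          using e'(2) unfolding 2 in_hull_edge by blast
        have "a = b" using t z by (intro nat_eq_of_real) linarith+
        moreover have "k = j" using t z \<open>a = b\<close> by (intro nat_eq_of_real) linarith+
        ultimately have False using t z by linarith
        then show ?thesis ..
      next
        case 3
        obtain t where t: "0 \<le> t" "t \<le> 1" "hv z = 3 * real b + 1 - 2 * t"
          using e'(2) unfolding 3 in_hull_edge by blast
        have "a = b" using t z by (intro nat_eq_of_real) linarith+
        then have False using t z by linarith
        then show ?thesis ..
      qed
    qed
  next
    case r
    obtain z where z: "hu z = 2 * real k - real a + 1 / 2" "hv z = 3 * real a - 3 / 2" using pt by blast
    show ?thesis
    proof
      show "z \<in> convex hull (pos ` e)"
        unfolding r in_hull_edge by (intro exI[of _ "1 / 2"]) (simp add: z)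
      fix e' assume e': "e' \<in> lattice_edges" "z \<in> convex hull (pos ` e')"
      from e'(1) consider b j where "e' = el b j" | b j where "e' = er b j" | b j where "e' = ev b j"
        by (auto simp: lattice_edges_def)
      then show "e' = e"
      proof cases
        case 1
        obtain t where t: "0 \<le> t" "t \<le> 1" "hu z = 2 * real j - real b - t" "hv z = 3 * real b - 2 + t"
          using e'(2) unfolding 1 in_hull_edge by blast
        have "a = b" using t z by (intro nat_eq_of_real) linarith+
        moreover have "k = j" using t z \<open>a = b\<close> by (intro nat_eq_of_real) linarith+
        ultimately have False using t z by linarith
        then show ?thesis ..
      next
        case 2
        obtain t where t: "0 \<le> t" "t \<le> 1" "hu z = 2 * real j - real b + t" "hv z = 3 * real b - 2 + t"
          using e'(2) unfolding 2 in_hull_edge by blast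
        have "a = b" using t z by (intro nat_eq_of_real) linarith+
        moreover have "k = j" using t z \<open>a = b\<close> by (intro nat_eq_of_real) linarith+
        ultimately show ?thesis by (simp add: 2 r)
      next
        case 3
        obtain t where t: "0 \<le> t" "t \<le> 1" "hv z = 3 * real b + 1 - 2 * t"
          using e'(2) unfolding 3 in_hull_edge by blast
        have "a = b" using t z by (intro nat_eq_of_real) linarith+
        then have False using t z by linarith
        then show ?thesis ..
      qed
    qed
  next
    case v
    obtain z where z: "hu z = 2 * real k - real a - 1" "hv z = 3 * real a" using pt by blast
    show ?thesis
    proof
      show "z \<in> convex hull (pos ` e)"
        unfolding v in_hull_edge by (intro exI[of _ "1 / 2"]) (simp add: z)
      fix e' assume e': "e' \<in> lattice_edges" "z \<in> convex hull (pos ` e')"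
      from e'(1) consider b j where "e' = el b j" | b j where "e' = er b j" | b j where "e' = ev b j"
        by (auto simp: lattice_edges_def)
      then show "e' = e"
      proof cases
        case 1
        obtain t where t: "0 \<le> t" "t \<le> 1" "hv z = 3 * real b - 2 + t"
          using e'(2) unfolding 1 in_hull_edge by blast
        have "a = b" using t z by (intro nat_eq_of_real) linarith+
        then have False using t z by linarith
        then show ?thesis ..
      next
        case 2
        obtain t where t: "0 \<le> t" "t \<le> 1" "hv z = 3 * real b - 2 + t"
          using e'(2) unfolding 2 in_hull_edge by blast
        have "a = b" using t z by (intro nat_eq_of_real) linarith+
        then have False using t z by linarith
        then show ?thesis ..
      next
        case 3
        obtain t where t: "0 \<le> t" "t \<le> 1" "hu z = 2 * real j - real b - 1" "hv z = 3 * real b + 1 - 2 * t"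
          using e'(2) unfolding 3 in_hull_edge by blast
        have "a = b" using t z by (intro nat_eq_of_real) linarith+
        moreover have "k = j" using t z \<open>a = b\<close> by (intro nat_eq_of_real) linarith+
        ultimately show ?thesis by (simp add: 3 v)
      qed
    qed
  qed
qed

text \<open>An arc relates \<open>sym_diff M1 M2\<close> to a face only through its drawing; this
  recovers the edges. The witness point of an edge lies on no other lattice edge, so an equal
  drawing must use the same edge.\<close>

lemma draw_inject:
  assumes "E \<subseteq> lattice_edges" "E' \<subseteq> lattice_edges" "draw E = draw E'"
  shows "E = E'"
proof -
  have sub: "E1 \<subseteq> E2" if E1: "E1 \<subseteq> lattice_edges" and E2: "E2 \<subseteq> lattice_edges" and eq: "draw E1 = draw E2" for E1 E2
  proof
    fix e assume "e \<in> E1"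
    then obtain z where z: "z \<in> convex hull (pos ` e)"
      "\<And>e'. e' \<in> lattice_edges \<Longrightarrow> z \<in> convex hull (pos ` e') \<Longrightarrow> e' = e"
      using lattice_edge_witness[of e] E1 by blast
    then have "z \<in> draw E2" using \<open>e \<in> E1\<close> eq in_draw_iff by blast
    then obtain e' where "e' \<in> E2" "z \<in> convex hull (pos ` e')"
      unfolding in_draw_iff by blast
    then show "e \<in> E2" using z(2)[of e'] E2 by auto
  qed
  show ?thesis using sub[of E E'] sub[of E' E] assms by auto
qed

section \<open>Signed area of proper alternating cycles\<close>

definition cross :: "pt \<Rightarrow> pt \<Rightarrow> real" where
  "cross p q = fst (pos p) * snd (pos q) - fst (pos q) * snd (pos p)"

text \<open>The shoelace term of an edge traversed from white to black. For a properly coloured edge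
  both sums have one term, which makes the value depend on the edge and not on an ordered
  pair.\<close>

definition white_black_cross :: "pt set \<Rightarrow> real" where
  "white_black_cross e = (\<Sum>p\<in>{p \<in> e. white p}. \<Sum>q\<in>{q \<in> e. \<not> white q}. cross p q)"

lemma white_black_cross:
  assumes "white p" "\<not> white q"
  shows "white_black_cross {p, q} = cross p q" "white_black_cross {q, p} = cross p q"
proof -
  have "{x \<in> {p, q}. white x} = {p}" "{x \<in> {p, q}. \<not> white x} = {q}"
    using assms by auto
  then show "white_black_cross {p, q} = cross p q"
    unfolding white_black_cross_def by simp
  then show "white_black_cross {q, p} = cross p q"
    by (simp add: insert_commute)
qed

text \<open>Two different indices with the same edge would traverse it in opposite directions, each
  being the successor of the other, which happens only in length 2.\<close>

lemma inj_on_cycle_edge: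
  assumes "distinct vs" "3 \<le> length vs"
  shows "inj_on (\<lambda>k. {vs ! k, vs ! (Suc k mod length vs)}) {..<length vs}"
proof (rule inj_onI)
  let ?n = "length vs"
  fix k l assume kl: "k \<in> {..<?n}" "l \<in> {..<?n}"
    and eq: "{vs ! k, vs ! (Suc k mod ?n)} = {vs ! l, vs ! (Suc l mod ?n)}"
  have lt: "Suc j mod ?n < ?n" for j
    using assms(2) by (intro mod_less_divisor) linarith
  have "vs ! k = vs ! l \<or> vs ! k = vs ! (Suc l mod ?n) \<and> vs ! (Suc k mod ?n) = vs ! l"
    using eq by (auto simp: doubleton_eq_iff)
  then have "k = l \<or> k = Suc l mod ?n \<and> Suc k mod ?n = l"
    using assms(1) kl lt by (auto simp: nth_eq_iff_index_eq)
  then show "k = l"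
    using kl assms(2) by (auto simp: mod_Suc split: if_splits)
qed

text \<open>
  In a proper alternating cycle every edge has a prescribed direction, so the area does not depend on
  the list of vertices but only on the set of edges.
\<close>

lemma signed_area2_proper_alternating:
  assumes vs: "distinct vs" "3 \<le> length vs" and alt: "alternating M vs" and prp: "proper M vs"
  shows "signed_area2 vs =
    (\<Sum>e\<in>cycle_edges vs. if e \<in> M then white_black_cross e else - white_black_cross e)"
proof -
  let ?n = "length vs"
  let ?e = "\<lambda>k. {vs ! k, vs ! (Suc k mod ?n)}"
  have n: "0 < ?n" using vs(2) by linarith
  have alt': "(?e k \<in> M) \<noteq> (?e (Suc k mod ?n) \<in> M)" if "k < ?n" for k
    using alt that unfolding alternating_def Let_def by (simp add: mod_Suc_eq)
  have prp': "white (vs ! k)" "\<not> white (vs ! (Suc k mod ?n))" if "k < ?n" "?e k \<in> M" for k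
    using prp that unfolding proper_def Let_def by auto
  have term_eq: "cross (vs ! k) (vs ! (Suc k mod ?n)) =
      (if ?e k \<in> M then white_black_cross (?e k) else - white_black_cross (?e k))" if k: "k < ?n" for k
  proof (cases "?e k \<in> M")
    case True
    then show ?thesis using prp'[OF k True] by (simp add: white_black_cross)
  next
    case False
    have "?e (Suc k mod ?n) \<in> M" using alt'[OF k] False by blast
    then have w: "white (vs ! (Suc k mod ?n))" using prp'(1)[of "Suc k mod ?n"] n by simp
    \<comment> \<open>The cyclic predecessor of \<open>k\<close>: its edge is in \<open>M\<close> by
      alternation, so properness makes its end \<open>vs ! k\<close> black.\<close>
    define j where "j = (if k = 0 then ?n - 1 else k - 1)"
    have j: "j < ?n" "Suc j mod ?n = k" using k n by (auto simp: j_def)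
    then have "?e j \<in> M" using alt'[OF j(1)] False by simp
    then have "\<not> white (vs ! k)" using prp'(2)[OF j(1)] j(2) by simp
    then show ?thesis using False w by (simp add: white_black_cross cross_def)
  qed
  have "signed_area2 vs = (\<Sum>k<?n. cross (vs ! k) (vs ! (Suc k mod ?n)))"
    by (simp add: signed_area2_def cross_def Let_def)
  also have "\<dots> = (\<Sum>k<?n. if ?e k \<in> M then white_black_cross (?e k) else - white_black_cross (?e k))"
    by (intro sum.cong refl term_eq) simp
  also have "\<dots> = (\<Sum>e\<in>?e ` {..<?n}. if e \<in> M then white_black_cross e else - white_black_cross e)"
    by (subst sum.reindex[OF inj_on_cycle_edge[OF vs]]) (simp add: o_def)
  also have "?e ` {..<?n} = cycle_edges vs"
    by (auto simp: cycle_edges_def)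
  finally show ?thesis .
qed

text \<open>Here \<open>M\<close> contains the left vertical side, and directing the matched sides
  from white to black runs counterclockwise, so the sign is opposite to that of
  \<open>corners\<close>.\<close>

lemma signed_area2_hexagon_left:
  assumes vs: "distinct vs" "3 \<le> length vs" and "alternating M vs" "proper M vs"
    and "cycle_edges vs = cycle_edges (corners (hx a k))"
    and "el a k \<notin> M" "er a k \<in> M" "ev a k \<in> M" "ev a (Suc k) \<notin> M"
      "er (Suc a) k \<notin> M" "el (Suc a) (Suc k) \<in> M"
  shows "signed_area2 vs = 3 * sqrt 3"
proof -
  have g: "white_black_cross (el a k) = cross (wv a k) (bv a k)"
    "white_black_cross (er a k) = cross (wv a k) (bv a (Suc k))"
    "white_black_cross (ev a k) = cross (wv (Suc a) k) (bv a k)" for a k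
    unfolding el_def er_def ev_def by (simp_all add: white_black_cross)
  show ?thesis
    unfolding signed_area2_proper_alternating[OF assms(1-4)] assms(5) cycle_edges_hx
    using assms(6-) by (simp add: g) (simp add: cross_def pos_def wv_def bv_def field_simps)
qed

section \<open>Arcs and reachability in terms of profiles\<close>

context truncated_parallelogram
begin

lemma edges_H_lattice: "edges H \<subseteq> lattice_edges"
  by (auto simp: edges_H lattice_edges_def)

lemma Z_arc_hexagon:
  assumes "Z_arc H M1 M2"
  obtains a k vs where "a < m" "k < r (Suc a)" "sym_diff M1 M2 = cycle_edges (corners (hx a k))"
    "is_cycle H vs" "cycle_edges vs = cycle_edges (corners (hx a k))" "clockwise vs"
    "alternating M1 vs" "proper M1 vs"
proof -
  obtain f vs where f: "f \<in> inner_faces H" "frontier f = draw (sym_diff M1 M2)"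
    and vs: "is_cycle H vs" "cycle_edges vs = sym_diff M1 M2" "clockwise vs" "alternating M1 vs" "proper M1 vs"
    using assms unfolding Z_arc_def by blast
  obtain a k where ak: "a < m" "k < r (Suc a)" "f = hexo (hx a k)"
    using f(1) unfolding inner_faces_H hexagons_hx by blast
  have "draw (sym_diff M1 M2) = draw (cycle_edges (corners (hx a k)))"
    using f(2) by (simp add: ak(3) frontier_hexo draw_corners)
  moreover have "sym_diff M1 M2 \<subseteq> lattice_edges"
  proof -
    have "M1 \<subseteq> edges H" "M2 \<subseteq> edges H"
      using assms by (simp_all add: Z_arc_def perfect_matchings_def)
    then show ?thesis using edges_H_lattice by blast
  qed
  moreover have "cycle_edges (corners (hx a k)) \<subseteq> lattice_edges"
    unfolding cycle_edges_hx lattice_edges_def by blast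
  ultimately have "sym_diff M1 M2 = cycle_edges (corners (hx a k))"
    by (intro draw_inject)
  with ak vs show ?thesis using that by metis
qed

lemma Z_arc_le:
  assumes P: "P \<in> profiles" and Q: "Q \<in> profiles" and arc: "Z_arc H (matching P) (matching Q)"
  shows "Q \<le> P"
proof -
  obtain a k vs where ak: "a < m" "k < r (Suc a)"
    and sd: "sym_diff (matching P) (matching Q) = cycle_edges (corners (hx a k))"
    and vs: "is_cycle H vs" "cycle_edges vs = cycle_edges (corners (hx a k))" "clockwise vs"
      "alternating (matching P) vs" "proper (matching P) vs"
    using Z_arc_hexagon[OF arc] by blast
  have sd_iff: "(e \<in> matching P) \<noteq> (e \<in> matching Q) \<longleftrightarrow>
      e \<in> {el a k, er a k, ev a k, ev a (Suc k), er (Suc a) k, el (Suc a) (Suc k)}" for e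
    using sd unfolding cycle_edges_hx by blast
  have other: "P (Suc b) = Q (Suc b)" if "b < m" "b \<noteq> a" for b
    using sd_iff[of "ev b (P (Suc b))"] that by auto
  have evs: "(k = P (Suc a)) \<noteq> (k = Q (Suc a))" "(Suc k = P (Suc a)) \<noteq> (Suc k = Q (Suc a))"
    using sd_iff[of "ev a k"] sd_iff[of "ev a (Suc k)"] ak(1) by auto
  \<comment> \<open>Otherwise the arc would move the vertical edge from the left side to the right
    side, and the cycle would be counterclockwise.\<close>
  have "P (Suc a) \<noteq> k"
  proof
    assume Pa: "P (Suc a) = k"
    then have Qa: "Q (Suc a) = Suc k" using evs by auto
    have le: "k \<le> P a" "Q (Suc (Suc a)) \<le> Suc k"
      using profileD(1)[OF P, of a] profileD(1)[OF Q, of "Suc a"] Pa Qa by auto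
    have "el a k \<notin> matching P" "ev a k \<in> matching P" "ev a (Suc k) \<notin> matching P" "er (Suc a) k \<notin> matching P"
      using Pa ak le by auto
    \<comment> \<open>The bound \<open>k \<le> P a\<close> does not decide whether
      \<open>er a k\<close> is in \<open>matching P\<close>, but membership in
      \<open>matching Q\<close> is clear and \<open>sd_iff\<close> flips it.\<close>
    moreover have "er a k \<notin> matching Q" "el (Suc a) (Suc k) \<notin> matching Q"
      using Qa le by auto
    then have "er a k \<in> matching P" "el (Suc a) (Suc k) \<in> matching P"
      using sd_iff[of "er a k"] sd_iff[of "el (Suc a) (Suc k)"] by auto
    ultimately have "signed_area2 vs = 3 * sqrt 3"
      using vs by (intro signed_area2_hexagon_left[of vs "matching P" a k]) (auto simp: is_cycle_def)
    then show False using vs(3) by (simp add: clockwise_def)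
  qed
  then have a: "Q (Suc a) \<le> P (Suc a)" using evs by auto
  have "Q b \<le> P b" for b
  proof (cases b)
    case 0
    then show ?thesis using profileD(2)[OF P] profileD(2)[OF Q] by simp
  next
    case (Suc c)
    then show ?thesis using a other[of c] profileD(4)[OF Q, of c] by (cases "c < m"; cases "c = a") auto
  qed
  then show ?thesis by (simp add: le_fun_def)
qed

lemma Z_arc_lower:
  assumes P: "P \<in> profiles" and Q: "Q \<in> profiles" and a: "a < m"
    and Pa: "P (Suc a) = Suc k" and Q_eq: "Q = P(Suc a := k)"
  shows "Z_arc H (matching P) (matching Q)"
proof -
  define M where "M = matching P"
  \<comment> \<open>\<open>P\<close> being decreasing yields \<open>Suc k \<le> P a\<close>, and
    \<open>Q\<close> being decreasing yields \<open>P (Suc (Suc a)) \<le> k\<close>; these make the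
    sides of \<open>hx a k\<close> alternate in \<open>matching P\<close>.\<close>
  have le: "Suc k \<le> P a" "P (Suc (Suc a)) \<le> k" "Suc k \<le> r (Suc a)" "P a \<le> width a"
    using profileD(1)[OF P, of a] profileD(1)[OF Q, of "Suc a"] profileD(3)[OF P a] profileD(5)[OF P, of a] a Pa
    by (auto simp: Q_eq)
  have sub: "matching P \<subseteq> edges H" "matching Q \<subseteq> edges H"
    using matching_subset P Q by auto
  have hex: "hx a k \<in> hexagons m r" using a le(3) by (auto simp: hexagons_hx)
  have hexE: "cycle_edges (corners (hx a k)) \<subseteq> edges H"
    using hex by (auto simp: edges_def trunc_para_def)
  have diff: "(e \<in> matching P) \<noteq> (e \<in> matching Q) \<longleftrightarrow> e \<in> cycle_edges (corners (hx a k))"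
    if e: "e \<in> lattice_edges" for e
  proof -
    consider (l) b j where "e = el b j" | (r) b j where "e = er b j" | (v) b j where "e = ev b j"
      using e by (auto simp: lattice_edges_def)
    then show ?thesis
    proof cases
      case l
      then show ?thesis
        using le a Pa by (cases "b = a"; cases "b = Suc a") (auto simp: Q_eq cycle_edges_hx)
    next
      case r
      then show ?thesis
        using le a Pa by (cases "b = a"; cases "b = Suc a") (auto simp: Q_eq cycle_edges_hx)
    next
      case v
      then show ?thesis
        using le a Pa by (cases "b = a") (auto simp: Q_eq cycle_edges_hx)
    qed
  qed
  have sd: "sym_diff (matching P) (matching Q) = cycle_edges (corners (hx a k))"
  proof (intro equalityI subsetI)
    fix e assume e: "e \<in> sym_diff (matching P) (matching Q)"
    then have "e \<in> lattice_edges" using sub edges_H_lattice by blast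
    with e diff show "e \<in> cycle_edges (corners (hx a k))" by blast
  next
    fix e assume e: "e \<in> cycle_edges (corners (hx a k))"
    then have "e \<in> lattice_edges" using hexE edges_H_lattice by blast
    with e diff show "e \<in> sym_diff (matching P) (matching Q)" by blast
  qed
  \<comment> \<open>The matched sides are every other one around \<open>hx a k\<close>, among them
    the right vertical one; clockwise, each leads from white to black.\<close>
  have mem: "el a k \<in> M" "er (Suc a) k \<in> M" "ev a (Suc k) \<in> M" "er a k \<notin> M" "el (Suc a) (Suc k) \<notin> M" "ev a k \<notin> M"
    using le a Pa by (auto simp: M_def)
  have all6: "(\<forall>j<Suc (Suc (Suc (Suc (Suc (Suc 0))))). R j) \<longleftrightarrow> R 0 \<and> R 1 \<and> R 2 \<and> R 3 \<and> R 4 \<and> R (5 :: nat)" for R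
    by (simp add: eval_nat_numeral All_less_Suc conj_ac)
  have "is_cycle H (corners (hx a k))"
    unfolding is_cycle_def
  proof (intro conjI)
    show "set (corners (hx a k)) \<subseteq> verts H"
      unfolding verts_H_Union using Union_mono[OF hexE] by (simp only: Union_cycle_edges)
  qed (simp_all add: corners_hx hexE[unfolded corners_hx])
  moreover have "alternating M (corners (hx a k))"
    using mem unfolding alternating_def Let_def el_def er_def ev_def
    by (simp add: corners_hx all6 insert_commute)
  moreover have "proper M (corners (hx a k))"
    using mem unfolding proper_def Let_def el_def er_def ev_def
    by (simp add: corners_hx all6 insert_commute)
  moreover have "frontier (hexo (hx a k)) = draw (sym_diff (matching P) (matching Q))"
    by (simp add: sd frontier_hexo draw_corners)
  ultimately show ?thesis
    unfolding Z_arc_def M_def inner_faces_H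
    using matching_perfect[OF P] matching_perfect[OF Q] hex
    by (intro conjI bexI[of _ "hexo (hx a k)"] exI[of _ "corners (hx a k)"])
      (simp_all add: sd corners_clockwise)
qed

lemma Z_path_le:
  assumes "(Z_arc H)\<^sup>*\<^sup>* M1 M2" "P \<in> profiles" "M1 = matching P"
  shows "\<exists>Q\<in>profiles. M2 = matching Q \<and> Q \<le> P"
  using assms(1)
proof induction
  case base
  then show ?case using assms by blast
next
  case (step M M')
  then obtain Q where Q: "Q \<in> profiles" "M = matching Q" "Q \<le> P" by blast
  have "M' \<in> perfect_matchings H" using step.hyps(2) by (simp add: Z_arc_def)
  then obtain R where R: "R \<in> profiles" "M' = matching R" using perfect_matching_profile by blast
  then have "R \<le> Q" using Z_arc_le[OF Q(1) R(1)] step.hyps(2) Q(2) by simp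
  then have "R \<le> P" using Q(3) by (rule order_trans)
  then show ?case using R by blast
qed

lemma le_Z_path:
  assumes "P \<in> profiles" "Q \<in> profiles" "Q \<le> P"
  shows "(Z_arc H)\<^sup>*\<^sup>* (matching P) (matching Q)"
  using assms(1,3)
\<comment> \<open>Beyond \<open>m\<close> every profile is \<open>0\<close>, so the finite sum
  decreases whenever a value is lowered.\<close>
proof (induction "\<Sum>a\<le>m. P a" arbitrary: P rule: less_induct)
  case less
  note P = less.prems(1)
  show ?case
  proof (cases "P = Q")
    case False
    define A where "A = {a. Q a < P a}"
    have "A \<noteq> {}"
      using False less.prems(2) unfolding A_def by (force simp: le_fun_def fun_eq_iff nat_less_le)
    have A_le: "a \<le> m" "a \<noteq> 0" if "a \<in> A" for a
      using that P profileD(2)[OF P] profileD(2)[OF assms(2)] unfolding A_def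
      by (auto simp: profiles_def not_le intro: ccontr)
    then have fin: "finite A" by (meson finite_atMost finite_subset atMost_iff subsetI)
    have Max_in: "Max A \<in> A" using Max_in[OF fin \<open>A \<noteq> {}\<close>] .
    then obtain a where a: "Max A = Suc a" using A_le(2) not0_implies_Suc by blast
    with Max_in have aA: "Q (Suc a) < P (Suc a)" "a < m" using A_le(1)[of "Suc a"] by (auto simp: A_def)
    \<comment> \<open>By maximality, \<open>P (Suc (Suc a)) \<le> Q (Suc (Suc a)) \<le> Q (Suc a) <
      P (Suc a)\<close>, so lowering \<open>P (Suc a)\<close> by one keeps the sequence weakly
      decreasing.\<close>
    have "Suc (Suc a) \<notin> A" using Max_ge[OF fin] a by fastforce
    then have above: "P (Suc (Suc a)) \<le> Q (Suc a)"
      using profileD(1)[OF assms(2), of "Suc a"] by (auto simp: A_def)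
    obtain k where k: "P (Suc a) = Suc k" using aA(1) by (cases "P (Suc a)") auto
    define R where "R = P(Suc a := k)"
    have R: "R \<in> profiles"
      unfolding profiles_def antimono_iff_le_Suc
    proof (intro CollectI conjI allI impI)
      show "R (Suc b) \<le> R b" for b
        using profileD(1)[OF P, of b] above aA k by (auto simp: R_def)
      show "R (Suc b) \<le> r (Suc b)" if "b < m" for b
        using profileD(3)[OF P that] k by (auto simp: R_def)
    qed (use P aA in \<open>auto simp: R_def profiles_def\<close>)
    have "Q \<le> R"
      using less.prems(2) aA(1) k by (auto simp: R_def le_fun_def)
    moreover have "(\<Sum>a\<le>m. R a) < (\<Sum>a\<le>m. P a)"
      by (rule sum_strict_mono_ex1) (use aA k in \<open>auto simp: R_def intro!: bexI[of _ "Suc a"]\<close>)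
    ultimately have "(Z_arc H)\<^sup>*\<^sup>* (matching R) (matching Q)"
      using less.hyps R by blast
    moreover have "Z_arc H (matching P) (matching R)"
      by (rule Z_arc_lower[OF P R aA(2) k R_def])
    ultimately show ?thesis by (rule converse_rtranclp_into_rtranclp[rotated])
  qed simp
qed

section \<open>The isomorphism\<close>

lemma perfect_matchings_eq: "perfect_matchings H = matching ` profiles"
proof
  show "perfect_matchings H \<subseteq> matching ` profiles"
    using perfect_matching_profile by (metis image_eqI subsetI)
  show "matching ` profiles \<subseteq> perfect_matchings H"
    using matching_perfect by auto
qed

lemma matching_poset_iso: "poset_isomorphic (matching_poset H) (ideal_lattice (hexagon_poset m r))"
proof -
  \<comment> \<open>This reads the ideal off the 1-factor itself: in \<open>matching P\<close> the
    only vertical edge of row \<open>a\<close> is at \<open>P (Suc a)\<close>, so \<open>l\<close>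
    can only be that position.\<close>
  define \<phi> where "\<phi> M = {hx a k | a k. \<exists>l>k. ev a l \<in> M}" for M
  have \<phi>: "\<phi> (matching P) = ideal_of P" for P
    by (auto simp: \<phi>_def ideal_of_def)
  have "inj_on \<phi> (perfect_matchings H)"
    unfolding perfect_matchings_eq
    by (auto simp: inj_on_def \<phi>) (metis antisym ideal_of_mono_iff order_refl)+
  moreover have "\<phi> ` perfect_matchings H = fst (ideal_lattice (hexagon_poset m r))"
    by (simp add: perfect_matchings_eq ideals_eq image_image \<phi>)
  ultimately have "bij_betw \<phi> (perfect_matchings H) (fst (ideal_lattice (hexagon_poset m r)))"
    by (simp add: bij_betw_def)
  moreover have "(Z_arc H)\<^sup>*\<^sup>* (matching Q) (matching P) \<longleftrightarrow> \<phi> (matching P) \<subseteq> \<phi> (matching Q)"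
    if "P \<in> profiles" "Q \<in> profiles" for P Q
    using that le_Z_path[of Q P] Z_path_le[of "matching Q" "matching P" Q] matching_inject[of P]
    by (auto simp: \<phi> ideal_of_mono_iff)
  ultimately show ?thesis
    unfolding poset_isomorphic_def
    by (intro exI[of _ \<phi>]) (auto simp: matching_poset_def ideal_lattice_def perfect_matchings_eq)
qed

end

theorem theorem4p6:
  fixes m :: nat and r :: "nat \<Rightarrow> nat"
  assumes "1 \<le> m"
    and "\<forall>i. 1 \<le> i \<and> i < m \<longrightarrow> r (Suc i) \<le> r i"
    and "1 \<le> r m"
  shows "poset_isomorphic (matching_poset (trunc_para m r)) (ideal_lattice (hexagon_poset m r))"
proof -
  interpret truncated_parallelogram m r
    using assms by unfold_locales auto
  show ?thesis by (rule matching_poset_iso)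
qed

end
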